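(* Let $(M,g)$ be a closed connected oriented smooth Riemannian manifold with Levi-Civita connection $\nabla^{\mathrm{LC}}$ and Riemann tensor $R(w^1,w^2)w^3=\nabla^{\mathrm{LC}}_{w^1}\nabla^{\mathrm{LC}}_{w^2}w^3-\nabla^{\mathrm{LC}}_{w^2}\nabla^{\mathrm{LC}}_{w^1}w^3-\nabla^{\mathrm{LC}}_{[w^1,w^2]}w^3$. The Riemann tensor $$\mathbf R^{\mathrm{der}}(V^1,V^2)V^3:=\boldsymbol\nabla^{\mathrm{LC}}_{V^1}\boldsymbol\nabla^{\mathrm{LC}}_{V^2}V^3-\boldsymbol\nabla^{\mathrm{LC}}_{V^2}\boldsymbol\nabla^{\mathrm{LC}}_{V^1}V^3-\boldsymbol\nabla^{\mathrm{LC}}_{\llbracket V^1,V^2\rrbracket}V^3$$ satisfies, for all $V^1,V^2,V^3\in\mathscr V\mathscr C^\infty_b$ and every $\mu\in\mathscr P$, $$\big(\mathbf R^{\mathrm{der}}(V^1,V^2)V^3\big)_\mu=R(V^1_\mu,V^2_\mu)V^3_\mu .$$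
   Context: $\mathscr P$ is the set of Borel probability measures on $M$; $\mathfrak X^\infty$ the smooth vector fields on $M$; $\Omega^\infty_1$ the smooth $1$-forms on $M$. For $f\in C^\infty(M)$ put $f^\star(\mu)=\mu f=\int f\,d\mu$. Cylinder functions: $\mathscr F\mathscr C^\infty_b$ is the algebra of functions $u:\mathscr P\to\mathbb R$ of the form $u=F\circ(f_1^\star,\dots,f_k^\star)$, $k\in\mathbb N_0$, $F\in C^\infty(\mathbb R^k)$, $f_i\in C^\infty(M)$. Cylinder vector fields: $\mathscr V\mathscr C^\infty_b:=\mathscr F\mathscr C^\infty_b\otimes_{\mathbb R}\mathfrak X^\infty$ (algebraic tensor product), a module over $\mathscr F\mathscr C^\infty_b$; for $V=\sum_iu_i\otimes w_i$ set $V_\mu=\sum_iu_i(\mu)w_i\in\mathfrak X^\infty$. Differential: $\mathbf D_\mu u=\sum_i(\partial_iF)(f_1^\star\mu,\dots,f_k^\star\mu)\,df_i$ (independent of the representation of $u$). Action on functions: $(Vu)(\mu)=\int(\mathbf D_\mu u)(V_\mu)\,d\mu$, so $Vu\in\mathscr F\mathscr C^\infty_b$. The map sending $V$ to the derivation $u\mapsto Vu$ is injective, and cylinder vector fields are identified with the corresponding derivations. Bracket: $\llbracket V,Z\rrbracket\in\mathscr V\mathscr C^\infty_b$ is the cylinder vector field with $\llbracket V,Z\rrbracket u=V(Zu)-Z(Vu)$ for all $u\in\mathscr F\mathscr C^\infty_b$. Connections: $\boldsymbol\nabla^{\mathrm{int}}$ is determined by $\mathbb R$-linearity in $Z$ and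 $\boldsymbol\nabla^{\mathrm{int}}_V(u\otimes w)=(Vu)\otimes w$; $\big((\boldsymbol\Omega^{\mathrm{LC}}Z)V\big)_\mu=\nabla^{\mathrm{LC}}_{V_\mu}Z_\mu$; and $\boldsymbol\nabla^{\mathrm{LC}}_VZ:=\boldsymbol\nabla^{\mathrm{int}}_VZ+(\boldsymbol\Omega^{\mathrm{LC}}Z)V\in\mathscr V\mathscr C^\infty_b$ for $V,Z\in\mathscr V\mathscr C^\infty_b$. *)

theory Defs
  imports
    "HOL-Probability.Probability"
    "HOL-Algebra.Free_Abelian_Groups"
    "Jordan_Normal_Form.Determinant"
begin

section \<open>Smooth functions on open subsets of Euclidean d-space\<close>

text \<open>
  The dimension has to be a natural number that can vary (cylinder functions use
  smooth functions of arbitrarily many variables), so Euclidean d-space is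
  \<^const>\<open>Euclidean_space\<close>: real sequences vanishing from index d on.
\<close>

definition partial_deriv :: "nat \<Rightarrow> ((nat \<Rightarrow> real) \<Rightarrow> real) \<Rightarrow> (nat \<Rightarrow> real) \<Rightarrow> real" where
  "partial_deriv i F x = deriv (\<lambda>t. F (x(i := t))) (x i)"

primrec Ck_on :: "nat \<Rightarrow> nat \<Rightarrow> (nat \<Rightarrow> real) set \<Rightarrow> ((nat \<Rightarrow> real) \<Rightarrow> real) \<Rightarrow> bool" where
  "Ck_on 0 d U F \<longleftrightarrow> continuous_map (subtopology (Euclidean_space d) U) euclideanreal F"
| "Ck_on (Suc n) d U F \<longleftrightarrow>
     continuous_map (subtopology (Euclidean_space d) U) euclideanreal F \<and>
     (\<forall>i<d. (\<forall>x\<in>U. (\<lambda>t. F (x(i := t))) differentiable (at (x i))) \<and>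
            Ck_on n d U (partial_deriv i F))"

definition smooth_on :: "nat \<Rightarrow> (nat \<Rightarrow> real) set \<Rightarrow> ((nat \<Rightarrow> real) \<Rightarrow> real) \<Rightarrow> bool" where
  "smooth_on d U F \<longleftrightarrow> (\<forall>n. Ck_on n d U F)"

section \<open>Smooth manifolds\<close>

text \<open>
  The points of the manifold are all elements of a type of class
  \<^class>\<open>t2_space\<close> and \<^class>\<open>second_countable_topology\<close>; a chart is a pair of its
  domain and its coordinate map. Charts take values in open subsets of Euclidean
  space, so manifolds have no boundary.
\<close>

type_synonym 'a chart = "'a set \<times> ('a \<Rightarrow> nat \<Rightarrow> real)"

record 'a manifold =
  mdim :: nat
  charts :: "'a chart set"

definition is_chart :: "nat \<Rightarrow> ('a::topological_space) chart \<Rightarrow> bool" where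
  "is_chart d = (\<lambda>(U, \<phi>). open U \<and> openin (Euclidean_space d) (\<phi> ` U) \<and>
     homeomorphic_map (top_of_set U) (subtopology (Euclidean_space d) (\<phi> ` U)) \<phi>)"

definition transition :: "'a chart \<Rightarrow> 'a chart \<Rightarrow> (nat \<Rightarrow> real) \<Rightarrow> nat \<Rightarrow> real" where
  "transition = (\<lambda>(U, \<phi>) (V, \<psi>) y. \<psi> (inv_into U \<phi> y))"

definition overlap :: "'a chart \<Rightarrow> 'a chart \<Rightarrow> (nat \<Rightarrow> real) set" where
  "overlap = (\<lambda>(U, \<phi>) (V, \<psi>). \<phi> ` (U \<inter> V))"

definition smooth_atlas :: "nat \<Rightarrow> ('a::topological_space) chart set \<Rightarrow> bool" where
  "smooth_atlas d A \<longleftrightarrow>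
     (\<forall>c\<in>A. is_chart d c) \<and> (\<Union>c\<in>A. fst c) = UNIV \<and>
     (\<forall>b\<in>A. \<forall>c\<in>A. \<forall>i<d. smooth_on d (overlap b c) (\<lambda>y. transition b c y i))"

definition smooth_manifold ::
  "('a::{t2_space, second_countable_topology}) manifold \<Rightarrow> bool" where
  "smooth_manifold M \<longleftrightarrow> smooth_atlas (mdim M) (charts M)"

text \<open>
  An orientation is given by an atlas belonging to the smooth structure of M all of
  whose transition maps have positive Jacobian determinant.
\<close>

definition jacobian_det :: "nat \<Rightarrow> ((nat \<Rightarrow> real) \<Rightarrow> nat \<Rightarrow> real) \<Rightarrow> (nat \<Rightarrow> real) \<Rightarrow> real" where
  "jacobian_det d T y =
     Determinant.det (Matrix.mat d d (\<lambda>(i, j). partial_deriv j (\<lambda>z. T z i) y))"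

definition orientation :: "('a::topological_space) manifold \<Rightarrow> 'a chart set \<Rightarrow> bool" where
  "orientation M Or \<longleftrightarrow>
     smooth_atlas (mdim M) Or \<and> smooth_atlas (mdim M) (charts M \<union> Or) \<and>
     (\<forall>b\<in>Or. \<forall>c\<in>Or. \<forall>y\<in>overlap b c. jacobian_det (mdim M) (transition b c) y > 0)"

definition smooth_funs :: "('a::topological_space) manifold \<Rightarrow> ('a \<Rightarrow> real) set" where
  "smooth_funs M =
     {f. \<forall>(U, \<phi>)\<in>charts M. smooth_on (mdim M) (\<phi> ` U) (\<lambda>y. f (inv_into U \<phi> y))}"

section \<open>Vector fields\<close>

text \<open>
  A tangent vector at x is an \<open>\<real>\<close>-linear Leibnizian functional on the smooth functions,
  and a vector field is smooth iff it maps smooth functions to smooth functions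
  (O'Neill, Semi-Riemannian Geometry, Chapter 1). Tangent vectors are set to 0 on
  non-smooth functions, so that equality of HOL functions is equality of tangent vectors.
\<close>

type_synonym 'a tvec = "('a \<Rightarrow> real) \<Rightarrow> real"
type_synonym 'a vfield = "'a \<Rightarrow> 'a tvec"

definition tangent_space :: "('a::topological_space) manifold \<Rightarrow> 'a \<Rightarrow> 'a tvec set" where
  "tangent_space M x = {v.
     (\<forall>f. f \<notin> smooth_funs M \<longrightarrow> v f = 0) \<and>
     (\<forall>f\<in>smooth_funs M. \<forall>h\<in>smooth_funs M. v (\<lambda>y. f y + h y) = v f + v h) \<and>
     (\<forall>c. \<forall>f\<in>smooth_funs M. v (\<lambda>y. c * f y) = c * v f) \<and>
     (\<forall>f\<in>smooth_funs M. \<forall>h\<in>smooth_funs M. v (\<lambda>y. f y * h y) = v f * h x + f x * v h)}"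

definition vector_fields :: "('a::topological_space) manifold \<Rightarrow> 'a vfield set" where
  "vector_fields M = {w. (\<forall>x. w x \<in> tangent_space M x) \<and>
     (\<forall>f\<in>smooth_funs M. (\<lambda>x. w x f) \<in> smooth_funs M)}"

definition vf_add :: "'a vfield \<Rightarrow> 'a vfield \<Rightarrow> 'a vfield" where
  "vf_add w z = (\<lambda>x f. w x f + z x f)"

definition vf_diff :: "'a vfield \<Rightarrow> 'a vfield \<Rightarrow> 'a vfield" where
  "vf_diff w z = (\<lambda>x f. w x f - z x f)"

definition vf_mult :: "('a \<Rightarrow> real) \<Rightarrow> 'a vfield \<Rightarrow> 'a vfield" where
  "vf_mult h w = (\<lambda>x f. h x * w x f)"

definition lie_bracket :: "'a vfield \<Rightarrow> 'a vfield \<Rightarrow> 'a vfield" where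
  "lie_bracket w z = (\<lambda>x f. w x (\<lambda>y. z y f) - z x (\<lambda>y. w y f))"

text \<open>The differential of f, a 1-form; covectors are set to 0 off the tangent space.\<close>

definition dform :: "('a::topological_space) manifold \<Rightarrow> ('a \<Rightarrow> real) \<Rightarrow> 'a \<Rightarrow> 'a tvec \<Rightarrow> real" where
  "dform M f x v = (if v \<in> tangent_space M x then v f else 0)"

section \<open>Riemannian metrics and the Levi-Civita connection\<close>

definition riemannian_metric ::
  "('a::topological_space) manifold \<Rightarrow> ('a \<Rightarrow> 'a tvec \<Rightarrow> 'a tvec \<Rightarrow> real) \<Rightarrow> bool" where
  "riemannian_metric M g \<longleftrightarrow>
     (\<forall>x. \<forall>v\<in>tangent_space M x. \<forall>w\<in>tangent_space M x. g x v w = g x w v) \<and>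
     (\<forall>x. \<forall>v\<in>tangent_space M x. \<forall>v'\<in>tangent_space M x. \<forall>w\<in>tangent_space M x. \<forall>a b.
        g x (\<lambda>f. a * v f + b * v' f) w = a * g x v w + b * g x v' w) \<and>
     (\<forall>x. \<forall>v\<in>tangent_space M x. v \<noteq> (\<lambda>f. 0) \<longrightarrow> g x v v > 0) \<and>
     (\<forall>w\<in>vector_fields M. \<forall>z\<in>vector_fields M. (\<lambda>x. g x (w x) (z x)) \<in> smooth_funs M)"

definition connection ::
  "('a::topological_space) manifold \<Rightarrow> ('a vfield \<Rightarrow> 'a vfield \<Rightarrow> 'a vfield) \<Rightarrow> bool" where
  "connection M nabla \<longleftrightarrow>
     (\<forall>w\<in>vector_fields M. \<forall>z\<in>vector_fields M. nabla w z \<in> vector_fields M) \<and>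
     (\<forall>w\<in>vector_fields M. \<forall>w'\<in>vector_fields M. \<forall>z\<in>vector_fields M.
        nabla (vf_add w w') z = vf_add (nabla w z) (nabla w' z)) \<and>
     (\<forall>h\<in>smooth_funs M. \<forall>w\<in>vector_fields M. \<forall>z\<in>vector_fields M.
        nabla (vf_mult h w) z = vf_mult h (nabla w z)) \<and>
     (\<forall>w\<in>vector_fields M. \<forall>z\<in>vector_fields M. \<forall>z'\<in>vector_fields M.
        nabla w (vf_add z z') = vf_add (nabla w z) (nabla w z')) \<and>
     (\<forall>h\<in>smooth_funs M. \<forall>w\<in>vector_fields M. \<forall>z\<in>vector_fields M.
        nabla w (vf_mult h z) = vf_add (vf_mult (\<lambda>x. w x h) z) (vf_mult h (nabla w z)))"

definition levi_civita ::
  "('a::topological_space) manifold \<Rightarrow> ('a \<Rightarrow> 'a tvec \<Rightarrow> 'a tvec \<Rightarrow> real) \<Rightarrow>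
   ('a vfield \<Rightarrow> 'a vfield \<Rightarrow> 'a vfield) \<Rightarrow> bool" where
  "levi_civita M g nabla \<longleftrightarrow> connection M nabla \<and>
     (\<forall>w\<in>vector_fields M. \<forall>z\<in>vector_fields M.
        vf_diff (nabla w z) (nabla z w) = lie_bracket w z) \<and>
     (\<forall>w\<in>vector_fields M. \<forall>z\<in>vector_fields M. \<forall>z'\<in>vector_fields M. \<forall>x.
        w x (\<lambda>y. g y (z y) (z' y)) = g x (nabla w z x) (z' x) + g x (z x) (nabla w z' x))"

definition riemann ::
  "('a vfield \<Rightarrow> 'a vfield \<Rightarrow> 'a vfield) \<Rightarrow> 'a vfield \<Rightarrow> 'a vfield \<Rightarrow> 'a vfield \<Rightarrow> 'a vfield" where
  "riemann nabla w1 w2 w3 =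
     vf_diff (vf_diff (nabla w1 (nabla w2 w3)) (nabla w2 (nabla w1 w3)))
             (nabla (lie_bracket w1 w2) w3)"

section \<open>Cylinder functions on the space of Borel probability measures\<close>

typedef (overloaded) 'a borel_prob =
  "{\<mu> :: ('a::topological_space) measure. prob_space \<mu> \<and> sets \<mu> = sets borel}"
  morphisms measure_of_prob Borel_Prob
proof -
  have "prob_space (return borel (undefined :: 'a))"
    by (rule prob_space_return) simp
  then show ?thesis by auto
qed

type_synonym 'a cylfun = "'a borel_prob \<Rightarrow> real"

definition star :: "(('a::topological_space) \<Rightarrow> real) \<Rightarrow> 'a cylfun" where
  "star f \<mu> = (\<integral>x. f x \<partial>measure_of_prob \<mu>)"

definition star_vec :: "nat \<Rightarrow> (nat \<Rightarrow> ('a::topological_space) \<Rightarrow> real) \<Rightarrow> 'a borel_prob \<Rightarrow> nat \<Rightarrow> real" where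
  "star_vec k f \<mu> = (\<lambda>i. if i < k then star (f i) \<mu> else 0)"

definition represents :: "('a::topological_space) manifold \<Rightarrow> nat \<Rightarrow> ((nat \<Rightarrow> real) \<Rightarrow> real) \<Rightarrow>
    (nat \<Rightarrow> 'a \<Rightarrow> real) \<Rightarrow> 'a cylfun \<Rightarrow> bool" where
  "represents M k F f u \<longleftrightarrow> smooth_on k (topspace (Euclidean_space k)) F \<and>
     (\<forall>i<k. f i \<in> smooth_funs M) \<and> u = (\<lambda>\<mu>. F (star_vec k f \<mu>))"

definition cylinder_funs :: "('a::topological_space) manifold \<Rightarrow> 'a cylfun set" where
  "cylinder_funs M = {u. \<exists>k F f. represents M k F f u}"

text \<open>
  The description below is definite because the 1-form does not depend on the
  representation of u.
\<close>

definition differential ::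
  "('a::topological_space) manifold \<Rightarrow> 'a cylfun \<Rightarrow> 'a borel_prob \<Rightarrow> 'a \<Rightarrow> 'a tvec \<Rightarrow> real" where
  "differential M u \<mu> = (THE \<omega>. \<exists>k F f. represents M k F f u \<and>
     \<omega> = (\<lambda>x v. \<Sum>i<k. partial_deriv i F (star_vec k f \<mu>) * dform M (f i) x v))"

section \<open>Cylinder vector fields\<close>

text \<open>
  The algebraic tensor product over \<open>\<real>\<close> of cylinder functions and vector fields: the
  free abelian group on the set of pairs modulo the subgroup generated by the
  biadditivity relations and \<open>(c u, w) - (u, c w)\<close> for real c. Its elements are
  cosets of formal integer combinations of pairs; scalars are absorbed by the factors.
\<close>

type_synonym 'a formal = "('a cylfun \<times> 'a vfield) \<Rightarrow>\<^sub>0 int"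
type_synonym 'a cylvec = "'a formal set"

definition formal_group :: "('a::topological_space) manifold \<Rightarrow> 'a formal monoid" where
  "formal_group M = free_Abelian_group (cylinder_funs M \<times> vector_fields M)"

definition tensor_relators :: "('a::topological_space) manifold \<Rightarrow> 'a formal set" where
  "tensor_relators M =
     {frag_of (\<lambda>\<mu>. u \<mu> + u' \<mu>, w) - frag_of (u, w) - frag_of (u', w) | u u' w.
        u \<in> cylinder_funs M \<and> u' \<in> cylinder_funs M \<and> w \<in> vector_fields M} \<union>
     {frag_of (u, vf_add w w') - frag_of (u, w) - frag_of (u, w') | u w w'.
        u \<in> cylinder_funs M \<and> w \<in> vector_fields M \<and> w' \<in> vector_fields M} \<union>
     {frag_of (\<lambda>\<mu>. c * u \<mu>, w) - frag_of (u, vf_mult (\<lambda>x. c) w) | c u w.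
        u \<in> cylinder_funs M \<and> w \<in> vector_fields M}"

definition tensor_relations :: "('a::topological_space) manifold \<Rightarrow> 'a formal set" where
  "tensor_relations M = generate (formal_group M) (tensor_relators M)"

definition cyl_group :: "('a::topological_space) manifold \<Rightarrow> 'a cylvec monoid" where
  "cyl_group M = formal_group M Mod tensor_relations M"

definition cylinder_fields :: "('a::topological_space) manifold \<Rightarrow> 'a cylvec set" where
  "cylinder_fields M = carrier (cyl_group M)"

definition tensor_class :: "('a::topological_space) manifold \<Rightarrow> 'a formal \<Rightarrow> 'a cylvec" where
  "tensor_class M a = tensor_relations M #>\<^bsub>formal_group M\<^esub> a"

definition cyl_rep :: "('a::topological_space) cylvec \<Rightarrow> 'a formal" where
  "cyl_rep V = (SOME a. a \<in> V)"

definition cyl_minus ::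
  "('a::topological_space) manifold \<Rightarrow> 'a cylvec \<Rightarrow> 'a cylvec \<Rightarrow> 'a cylvec" where
  "cyl_minus M V Z = V \<otimes>\<^bsub>cyl_group M\<^esub> inv\<^bsub>cyl_group M\<^esub> Z"

text \<open>
  \<open>cyl_at V \<mu>\<close> is the vector field \<open>V\<^sub>\<mu>\<close>, i.e. the sum of the \<open>u\<^sub>i(\<mu>) w\<^sub>i\<close> for
  V the class of the sum of the \<open>u\<^sub>i \<otimes> w\<^sub>i\<close>; it does not depend on the representative.
\<close>

definition cyl_at :: "('a::topological_space) cylvec \<Rightarrow> 'a borel_prob \<Rightarrow> 'a vfield" where
  "cyl_at V \<mu> = (\<lambda>x f. \<Sum>(u, w)\<in>Poly_Mapping.keys (cyl_rep V).
     of_int (Poly_Mapping.lookup (cyl_rep V) (u, w)) * u \<mu> * w x f)"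

definition act :: "('a::topological_space) manifold \<Rightarrow> 'a cylvec \<Rightarrow> 'a cylfun \<Rightarrow> 'a cylfun" where
  "act M V u = (\<lambda>\<mu>. \<integral>x. differential M u \<mu> x (cyl_at V \<mu> x) \<partial>measure_of_prob \<mu>)"

definition cyl_bracket ::
  "('a::topological_space) manifold \<Rightarrow> 'a cylvec \<Rightarrow> 'a cylvec \<Rightarrow> 'a cylvec" where
  "cyl_bracket M V Z = (THE B. B \<in> cylinder_fields M \<and>
     (\<forall>u\<in>cylinder_funs M. act M B u = (\<lambda>\<mu>. act M V (act M Z u) \<mu> - act M Z (act M V u) \<mu>)))"

section \<open>Connections on cylinder vector fields\<close>

text \<open>
  The linear extension of \<open>u \<otimes> w \<mapsto> (Vu) \<otimes> w\<close>, computed on a representative.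
\<close>

definition nabla_int ::
  "('a::topological_space) manifold \<Rightarrow> 'a cylvec \<Rightarrow> 'a cylvec \<Rightarrow> 'a cylvec" where
  "nabla_int M V Z =
     tensor_class M (frag_extend (\<lambda>(u, w). frag_of (act M V u, w)) (cyl_rep Z))"

text \<open>\<open>Omega_LC M nabla Z V\<close> is the cylinder vector field \<open>(\<Omega>\<^sup>L\<^sup>C Z) V\<close>.\<close>

definition Omega_LC :: "('a::topological_space) manifold \<Rightarrow>
    ('a vfield \<Rightarrow> 'a vfield \<Rightarrow> 'a vfield) \<Rightarrow> 'a cylvec \<Rightarrow> 'a cylvec \<Rightarrow> 'a cylvec" where
  "Omega_LC M nabla Z V = (THE T. T \<in> cylinder_fields M \<and>
     (\<forall>\<mu>. cyl_at T \<mu> = nabla (cyl_at V \<mu>) (cyl_at Z \<mu>)))"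

definition nabla_LC :: "('a::topological_space) manifold \<Rightarrow>
    ('a vfield \<Rightarrow> 'a vfield \<Rightarrow> 'a vfield) \<Rightarrow> 'a cylvec \<Rightarrow> 'a cylvec \<Rightarrow> 'a cylvec" where
  "nabla_LC M nabla V Z = nabla_int M V Z \<otimes>\<^bsub>cyl_group M\<^esub> Omega_LC M nabla Z V"

definition riemann_der :: "('a::topological_space) manifold \<Rightarrow>
    ('a vfield \<Rightarrow> 'a vfield \<Rightarrow> 'a vfield) \<Rightarrow> 'a cylvec \<Rightarrow> 'a cylvec \<Rightarrow> 'a cylvec \<Rightarrow> 'a cylvec" where
  "riemann_der M nabla V1 V2 V3 =
     cyl_minus M
       (cyl_minus M (nabla_LC M nabla V1 (nabla_LC M nabla V2 V3))
                    (nabla_LC M nabla V2 (nabla_LC M nabla V1 V3)))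
       (nabla_LC M nabla (cyl_bracket M V1 V2) V3)"

end

(*
  A cylinder field is identified with the function mu |-> V_mu: after eliminating linearly
  dependent vector fields, an element of the tensor product that vanishes at every mu is zero.
  Under this identification the intrinsic part of the connection differentiates V_mu in mu,
  and the Levi-Civita part is a bilinear map applied pointwise, so the Leibniz rule reduces
  the curvature to the one of M once the bracket is known to be
  [[V,Z]]_mu = D_V Z_mu - D_Z V_mu + [V_mu, Z_mu].
  This needs symmetry of second derivatives and that a field V with int V_mu f dmu = 0 for all f and mu vanishes.
  For the latter, if nu has an atom at x, test functions that concentrate at x show that V_nu is
  zero at x; then let nu = (1-t) mu + t delta_x tend to mu.
*)
theory Submission
  imports Defs
begin

section \<open>Calculus in Euclidean d-space\<close>

text \<open>A cylinder function u lives only on probability measures, so it does not determine the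
  partial derivatives of F at \<open>star_vec k f \<mu>\<close>: the values of
  \<open>star_vec k f\<close> may fill a set without interior, as for f_1 = f_2. What u does
  determine are its one-sided derivatives along the segments from \<mu> to a point mass. They are
  enough, because they fix the 1-form up to the differential of a constant. The same segments later
  supply the atoms. \<open>differential\<close>, \<open>cyl_bracket\<close> and
  \<open>Omega_LC\<close> are definite descriptions, so nothing can be computed with them before
  existence and uniqueness are known. Uniqueness comes from the segments in the first case and from
  the two injectivity results (evaluation at measures, action on functions) in the others; existence
  comes from explicit candidates, built from finite sums of \<open>u i \<mu> * w i x f\<close>. For
  fixed \<mu> the coefficients of such a sum are constants on M, so every operation on vector fields
  that is bilinear over the reals extends to cylinder fields, whether or not it is
  tensorial.\<close>

abbreviation Espace :: "nat \<Rightarrow> (nat \<Rightarrow> real) set" where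
  "Espace d \<equiv> topspace (Euclidean_space d)"

text \<open>Passes from an abstract topology to the type class topology on functions, where
  \<open>continuous_on\<close> and limits along filters are available.\<close>

lemma Euclidean_space_eq_top_of_set: "Euclidean_space d = top_of_set {x. \<forall>i\<ge>d. x i = 0}"
  by (simp add: Euclidean_space_def euclidean_product_topology)

lemma continuous_map_Euclidean_space_iff:
  "U \<subseteq> Espace d \<Longrightarrow>
   continuous_map (subtopology (Euclidean_space d) U) euclideanreal F \<longleftrightarrow> continuous_on U F"
  by (simp add: Euclidean_space_eq_top_of_set subtopology_subtopology inf.absorb2)

lemma fun_upd_in_Espace: "x \<in> Espace d \<Longrightarrow> i < d \<Longrightarrow> x(i := t) \<in> Espace d"
  by (auto simp: topspace_Euclidean_space)

lemma tendsto_fun_coordinatewise: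
  fixes f :: "'b \<Rightarrow> 'a \<Rightarrow> 'c::topological_space"
  assumes "\<And>i. ((\<lambda>t. f t i) \<longlongrightarrow> l i) F"
  shows "(f \<longlongrightarrow> l) F"
proof -
  have "limitin (product_topology (\<lambda>i. euclidean) UNIV) f l F"
    using assms by (subst limitin_componentwise) auto
  then show ?thesis
    by (simp add: euclidean_product_topology)
qed

text \<open>U is open only relative to \<open>Espace d\<close>, but changing a coordinate below d
  does not leave \<open>Espace d\<close>. This is what makes partial derivatives local.\<close>

lemma eventually_fun_upd_in:
  assumes "openin (Euclidean_space d) U" "x \<in> U" "i < d"
  shows "\<forall>\<^sub>F t in nhds (x i). x(i := t) \<in> U"
proof -
  obtain W where W: "open W" "U = Espace d \<inter> W"
    using assms(1) by (auto simp: Euclidean_space_eq_top_of_set openin_open)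
  have "((\<lambda>t. x(i := t)) \<longlongrightarrow> x) (nhds (x i))"
  proof (rule tendsto_fun_coordinatewise)
    fix j
    show "((\<lambda>t. (x(i := t)) j) \<longlongrightarrow> x j) (nhds (x i))"
      by (cases "j = i") (simp_all add: filterlim_ident)
  qed
  then have "\<forall>\<^sub>F t in nhds (x i). x(i := t) \<in> W"
    using W assms(2) by (auto simp: tendsto_def)
  then show ?thesis
    using W assms by (auto simp: fun_upd_in_Espace elim: eventually_mono)
qed

section \<open>C^k functions: locality and closure properties\<close>

lemma Ck_on_SucI:
  assumes U: "openin (Euclidean_space d) U"
    and cont: "continuous_on U F"
    and der: "\<And>i x. i < d \<Longrightarrow> x \<in> U \<Longrightarrow>
      ((\<lambda>t. F (x(i := t))) has_real_derivative F' i x) (at (x i))"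
    and Ck: "\<And>i. i < d \<Longrightarrow> Ck_on n d U (partial_deriv i F)"
  shows "Ck_on (Suc n) d U F"
proof -
  have "U \<subseteq> Espace d"
    using U openin_subset by blast
  then show ?thesis
    using cont Ck by (auto simp: continuous_map_Euclidean_space_iff real_differentiable_def intro!: exI der)
qed

lemma openin_Espace: "openin (Euclidean_space d) (Espace d)"
  by simp

lemma Ck_on_0_iff: "openin (Euclidean_space d) U \<Longrightarrow> Ck_on 0 d U F \<longleftrightarrow> continuous_on U F"
  by (simp add: continuous_map_Euclidean_space_iff openin_subset)

lemma Ck_on_continuous:
  "openin (Euclidean_space d) U \<Longrightarrow> Ck_on n d U F \<Longrightarrow> continuous_on U F"
  by (cases n) (auto simp: continuous_map_Euclidean_space_iff dest: openin_subset)

lemma Ck_on_deriv: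
  assumes "Ck_on (Suc n) d U F" "i < d" "x \<in> U"
  shows "((\<lambda>t. F (x(i := t))) has_real_derivative partial_deriv i F x) (at (x i))"
  using assms by (simp add: partial_deriv_def DERIV_deriv_iff_real_differentiable)

lemma Ck_on_deriv_at:
  assumes "Ck_on (Suc n) d (Espace d) F" "i < d" "x \<in> Espace d"
  shows "((\<lambda>t. F (x(i := t))) has_real_derivative partial_deriv i F (x(i := s))) (at s)"
  using Ck_on_deriv[OF assms(1,2) fun_upd_in_Espace[OF assms(3,2), of s]] by simp

text \<open>\<open>partial_deriv i\<close> sees F on a whole coordinate line, but a derivative
  depends only on values near the point, and near a point of the open set U the line stays in
  U.\<close>

lemma Ck_on_cong:
  assumes U: "openin (Euclidean_space d) U" and "Ck_on n d U F" "\<And>x. x \<in> U \<Longrightarrow> F x = G x"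
  shows "Ck_on n d U G"
  using assms(2,3)
proof (induction n arbitrary: F G)
  case 0
  then show ?case
    using U by (simp add: continuous_map_Euclidean_space_iff openin_subset
        cong: continuous_on_cong)
next
  case (Suc n)
  have ev: "\<forall>\<^sub>F t in nhds (x i). F (x(i := t)) = G (x(i := t))" if "x \<in> U" "i < d" for x i
    by (rule eventually_mono[OF eventually_fun_upd_in[OF U that]]) (rule Suc.prems(2))
  have pd: "partial_deriv i F x = partial_deriv i G x" if "x \<in> U" "i < d" for x i
    unfolding partial_deriv_def by (rule deriv_cong_ev[OF ev[OF that] refl])
  show ?case
  proof (rule Ck_on_SucI[OF U])
    show "continuous_on U G"
      using Ck_on_continuous[OF U Suc.prems(1)] Suc.prems(2) by (simp cong: continuous_on_cong)
    fix i assume i: "i < d"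
    show "Ck_on n d U (partial_deriv i G)"
      using Suc.IH[of "partial_deriv i F" "partial_deriv i G"] Suc.prems(1) i pd by auto
    fix x assume x: "x \<in> U"
    show "((\<lambda>t. G (x(i := t))) has_real_derivative partial_deriv i F x) (at (x i))"
      using Ck_on_deriv[OF Suc.prems(1) i x] DERIV_cong_ev[OF refl ev[OF x i] refl] by blast
  qed
qed

text \<open>Derivative formulas hold only on U, so \<open>partial_deriv i F\<close> and the formula
  \<open>F' i\<close> may differ as functions. \<open>Ck_on_cong\<close> carries the regularity
  across; all closure properties are proved in this form.\<close>

lemma Ck_on_SucI':
  assumes U: "openin (Euclidean_space d) U"
    and cont: "continuous_on U F"
    and der: "\<And>i x. i < d \<Longrightarrow> x \<in> U \<Longrightarrow>
      ((\<lambda>t. F (x(i := t))) has_real_derivative F' i x) (at (x i))"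
    and Ck: "\<And>i. i < d \<Longrightarrow> Ck_on n d U (F' i)"
  shows "Ck_on (Suc n) d U F"
proof (rule Ck_on_SucI[OF U cont der])
  fix i assume i: "i < d"
  show "Ck_on n d U (partial_deriv i F)"
    by (rule Ck_on_cong[OF U Ck[OF i]]) (simp add: partial_deriv_def DERIV_imp_deriv[OF der[OF i]])
qed

lemma Ck_on_SucD: "openin (Euclidean_space d) U \<Longrightarrow> Ck_on (Suc n) d U F \<Longrightarrow> Ck_on n d U F"
  by (induction n arbitrary: F) auto

lemma Ck_on_partial: "Ck_on (Suc n) d U F \<Longrightarrow> i < d \<Longrightarrow> Ck_on n d U (partial_deriv i F)"
  by simp

lemma Ck_on_const: "openin (Euclidean_space d) U \<Longrightarrow> Ck_on n d U (\<lambda>x. c)"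
proof (induction n arbitrary: c)
  case (Suc n)
  then show ?case by (intro Ck_on_SucI'[where F' = "\<lambda>i x. 0"]) auto
qed simp

lemma Ck_on_add:
  assumes U: "openin (Euclidean_space d) U" and "Ck_on n d U F" "Ck_on n d U G"
  shows "Ck_on n d U (\<lambda>x. F x + G x)"
  using assms(2,3)
proof (induction n arbitrary: F G)
  case 0
  then show ?case
    using U by (auto simp: continuous_map_Euclidean_space_iff openin_subset intro!: continuous_intros)
next
  case (Suc n)
  note [intro] = Ck_on_continuous[OF U Suc.prems(1)] Ck_on_continuous[OF U Suc.prems(2)]
  show ?case
  proof (rule Ck_on_SucI'[OF U, where F' = "\<lambda>i x. partial_deriv i F x + partial_deriv i G x"])
    show "continuous_on U (\<lambda>x. F x + G x)"
      by (auto intro!: continuous_intros)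
    fix i assume i: "i < d"
    show "Ck_on n d U (\<lambda>x. partial_deriv i F x + partial_deriv i G x)"
      by (intro Suc.IH Ck_on_partial[OF Suc.prems(1) i] Ck_on_partial[OF Suc.prems(2) i])
    fix x assume x: "x \<in> U"
    show "((\<lambda>t. F (x(i := t)) + G (x(i := t))) has_real_derivative
        partial_deriv i F x + partial_deriv i G x) (at (x i))"
      by (intro DERIV_add Ck_on_deriv[OF Suc.prems(1) i x] Ck_on_deriv[OF Suc.prems(2) i x])
  qed
qed

lemma Ck_on_mult:
  assumes U: "openin (Euclidean_space d) U" and "Ck_on n d U F" "Ck_on n d U G"
  shows "Ck_on n d U (\<lambda>x. F x * G x)"
  using assms(2,3)
proof (induction n arbitrary: F G)
  case 0
  then show ?case
    using U by (auto simp: continuous_map_Euclidean_space_iff openin_subset intro!: continuous_intros)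
next
  case (Suc n)
  note [intro] = Ck_on_continuous[OF U Suc.prems(1)] Ck_on_continuous[OF U Suc.prems(2)]
  show ?case
  proof (rule Ck_on_SucI'[OF U, where F' = "\<lambda>i x. partial_deriv i F x * G x + partial_deriv i G x * F x"])
    show "continuous_on U (\<lambda>x. F x * G x)"
      by (auto intro!: continuous_intros)
    fix i assume i: "i < d"
    show "Ck_on n d U (\<lambda>x. partial_deriv i F x * G x + partial_deriv i G x * F x)"
      using Suc.prems i by (intro Ck_on_add[OF U] Suc.IH) (auto intro: Ck_on_SucD[OF U] simp del: Ck_on.simps(2) dest: Ck_on_partial)
    fix x assume x: "x \<in> U"
    show "((\<lambda>t. F (x(i := t)) * G (x(i := t))) has_real_derivative
        partial_deriv i F x * G x + partial_deriv i G x * F x) (at (x i))"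
      by (rule DERIV_cong[OF DERIV_mult[OF Ck_on_deriv[OF Suc.prems(1) i x] Ck_on_deriv[OF Suc.prems(2) i x]]])
        simp
  qed
qed

lemma Ck_on_inverse:
  assumes U: "openin (Euclidean_space d) U" and "Ck_on n d U F" and nz: "\<And>x. x \<in> U \<Longrightarrow> F x \<noteq> 0"
  shows "Ck_on n d U (\<lambda>x. inverse (F x))"
  using assms(2)
proof (induction n)
  case 0
  then show ?case
    using U nz by (auto simp: continuous_map_Euclidean_space_iff openin_subset intro!: continuous_intros)
next
  case (Suc n)
  note c = Ck_on_continuous[OF U Suc.prems]
  \<comment> \<open>The derivative contains \<open>inverse (F x)\<close> for the same F, so one
    order lower is exactly what is needed.\<close>
  have IH: "Ck_on n d U (\<lambda>x. inverse (F x))"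
    using Suc by (metis Ck_on_SucD[OF U])
  show ?case
  proof (rule Ck_on_SucI'[OF U, where F' = "\<lambda>i x. (- 1) * (partial_deriv i F x * (inverse (F x) * inverse (F x)))"])
    show "continuous_on U (\<lambda>x. inverse (F x))"
      using c nz by (auto intro!: continuous_intros)
    fix i assume i: "i < d"
    show "Ck_on n d U (\<lambda>x. (- 1) * (partial_deriv i F x * (inverse (F x) * inverse (F x))))"
      by (intro Ck_on_mult[OF U] Ck_on_const[OF U] IH Ck_on_partial[OF Suc.prems i])
    fix x assume x: "x \<in> U"
    show "((\<lambda>t. inverse (F (x(i := t)))) has_real_derivative
        (- 1) * (partial_deriv i F x * (inverse (F x) * inverse (F x)))) (at (x i))"
      by (rule DERIV_cong[OF DERIV_inverse'[OF Ck_on_deriv[OF Suc.prems i x]]]) (use nz[OF x] in simp_all)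
  qed
qed

lemma Ck_on_coordinate:
  assumes U: "openin (Euclidean_space d) U"
  shows "Ck_on n d U (\<lambda>x. x j)"
proof (cases n)
  case 0
  show ?thesis
    unfolding 0 using U by (auto simp: continuous_map_Euclidean_space_iff openin_subset
        intro: continuous_on_subset[OF continuous_on_product_coordinates])
next
  case (Suc m)
  show ?thesis
    unfolding Suc
    by (rule Ck_on_SucI'[OF U, where F' = "\<lambda>i x. if i = j then 1 else 0"])
      (auto intro: continuous_on_subset[OF continuous_on_product_coordinates] Ck_on_const[OF U]
        split: if_split)
qed

text \<open>Regards a function of k variables as one of m variables, in order to write two cylinder
  functions over one list of test functions. As \<sigma> is injective, each variable of y feeds at
  most one slot of F, so every partial derivative is a single reindexed partial derivative of F or
  0.\<close>

lemma Ck_on_reindex: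
  assumes "Ck_on n k (Espace k) F" and inj: "inj_on \<sigma> {..<k}" and into: "\<sigma> ` {..<k} \<subseteq> {..<m}"
  shows "Ck_on n m (Espace m) (\<lambda>y. F (\<lambda>i. if i < k then y (\<sigma> i) else 0))"
  using assms(1)
proof (induction n arbitrary: F)
  have in_k: "(\<lambda>i. if i < k then y (\<sigma> i) else 0) \<in> Espace k" for y :: "nat \<Rightarrow> real"
    by (simp add: topspace_Euclidean_space)
  have cont: "continuous_on (Espace m) (\<lambda>y. F (\<lambda>i. if i < k then y (\<sigma> i) else 0))"
    if "continuous_on (Espace k) F" for F :: "(nat \<Rightarrow> real) \<Rightarrow> real"
  proof (rule continuous_on_compose2[OF that])
    show "continuous_on (Espace m) (\<lambda>y i. if i < k then y (\<sigma> i) else (0::real))"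
    proof (rule continuous_on_coordinatewise_then_product)
      fix i
      show "continuous_on (Espace m) (\<lambda>y. if i < k then y (\<sigma> i) else (0::real))"
        by (cases "i < k") (auto intro: continuous_on_subset[OF continuous_on_product_coordinates])
    qed
  qed (use in_k in auto)
  {
    case 0
    then show ?case
      using cont[of F] Ck_on_0_iff[OF openin_Espace] by blast
  next
    case (Suc n)
    define G where "G j y = (if j \<in> \<sigma> ` {..<k}
      then partial_deriv (inv_into {..<k} \<sigma> j) F (\<lambda>i. if i < k then y (\<sigma> i) else 0) else 0)" for j y
    show ?case
    proof (rule Ck_on_SucI'[OF openin_Espace, where F' = G])
      show "continuous_on (Espace m) (\<lambda>y. F (\<lambda>i. if i < k then y (\<sigma> i) else 0))"
        by (intro cont Ck_on_continuous[OF openin_Espace Suc.prems])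
      fix j assume j: "j < m"
      show "Ck_on n m (Espace m) (G j)"
      proof (cases "j \<in> \<sigma> ` {..<k}")
        case True
        then have "inv_into {..<k} \<sigma> j < k"
          using inv_into_into[OF True] by simp
        then show ?thesis
          unfolding G_def using True by (simp only: if_True) (intro Suc.IH Ck_on_partial[OF Suc.prems])
      next
        case False
        then show ?thesis
          unfolding G_def by (simp only: if_False) (intro Ck_on_const openin_Espace)
      qed
      fix y assume y: "y \<in> Espace m"
      let ?p = "\<lambda>i. if i < k then y (\<sigma> i) else 0"
      show "((\<lambda>t. F (\<lambda>i. if i < k then (y(j := t)) (\<sigma> i) else 0)) has_real_derivative G j y) (at (y j))"
      proof (cases "j \<in> \<sigma> ` {..<k}")
        case True
        then obtain i0 where i0: "i0 < k" "j = \<sigma> i0" by auto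
        then have inv: "inv_into {..<k} \<sigma> j = i0"
          using inj by simp
        have "(\<lambda>i. if i < k then (y(j := t)) (\<sigma> i) else 0) = ?p(i0 := t)" for t
          using i0 inj by (auto simp: fun_eq_iff inj_on_eq_iff)
        then show ?thesis
          using Ck_on_deriv[OF Suc.prems i0(1) in_k[of y]] True inv i0
          by (simp add: G_def del: fun_upd_apply)
      next
        case False
        then have "(\<lambda>i. if i < k then (y(j := t)) (\<sigma> i) else 0) = ?p" for t
          by (fastforce simp: fun_eq_iff)
        then show ?thesis
          using False by (simp add: G_def)
      qed
    qed
  }
qed

section \<open>The chain rule along lines and the symmetry of second derivatives\<close>

lemma mean_value_abs:
  fixes g :: "real \<Rightarrow> real"
  assumes "\<And>x. (g has_real_derivative g' x) (at x)"
  shows "\<exists>\<xi>. \<bar>\<xi> - a\<bar> \<le> \<bar>b - a\<bar> \<and> g b - g a = (b - a) * g' \<xi>"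
proof -
  consider "a < b" | "a = b" | "b < a" by linarith
  then show ?thesis
  proof cases
    case 1
    then obtain z where "a < z" "z < b" "g b - g a = (b - a) * g' z"
      using MVT2[of a b g g'] assms by blast
    then show ?thesis by (intro exI[of _ z]) auto
  next
    case 2
    then show ?thesis by (auto intro: exI[of _ a])
  next
    case 3
    then obtain z where "b < z" "z < a" "g a - g b = (a - b) * g' z"
      using MVT2[of b a g g'] assms by blast
    then show ?thesis by (intro exI[of _ z]) (auto simp: algebra_simps)
  qed
qed

text \<open>Only partial derivatives are at hand, so the coordinates are moved one after the other:
  \<open>A m t\<close> has the first m coordinates moved. Passing from m to m + 1 changes a single
  coordinate, where the mean value theorem applies, and continuity of the partial derivative at p
  gives the limit. The default 0 from index k on keeps the point in \<open>Espace k\<close> for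
  arbitrary v.\<close>

lemma Ck_on_line_deriv:
  assumes F: "Ck_on (Suc 0) k (Espace k) F" and p: "p \<in> Espace k"
  shows "((\<lambda>t. F (\<lambda>i. if i < k then p i + t * v i else 0)) has_real_derivative
           (\<Sum>i<k. partial_deriv i F p * v i)) (at 0)"
proof -
  define A where "A m t = (\<lambda>i. if i < m then p i + t * v i else p i)" for m t
  have A_in: "A m t \<in> Espace k" if "m \<le> k" for m t
    using p that by (auto simp: A_def topspace_Euclidean_space)
  have "((\<lambda>t. F (A m t)) has_real_derivative (\<Sum>i<m. partial_deriv i F p * v i)) (at 0)"
    if "m \<le> k" for m
    using that
  proof (induction m)
    case 0
    then show ?case by (simp add: A_def)
  next
    case (Suc m)
    have A_Suc: "A (Suc m) t = (A m t)(m := p m + t * v m)" "A m t = (A m t)(m := p m)" for t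
      by (auto simp: A_def fun_eq_iff less_Suc_eq)
    define g where "g t s = F ((A m t)(m := s))" for t s
    have "(g t has_real_derivative partial_deriv m F ((A m t)(m := s))) (at s)" for t s
      unfolding g_def using Suc.prems by (intro Ck_on_deriv_at[OF F] A_in) auto
    \<comment> \<open>The increment \<open>t * v m\<close> may be positive, negative or 0, which is
      why the mean value theorem is used with absolute values and without an order on the
      endpoints.\<close>
    then have "\<exists>\<xi>. \<bar>\<xi> - p m\<bar> \<le> \<bar>p m + t * v m - p m\<bar> \<and>
        g t (p m + t * v m) - g t (p m) = (p m + t * v m - p m) * partial_deriv m F ((A m t)(m := \<xi>))" for t
      by (rule mean_value_abs)
    then obtain \<xi> where \<xi>: "\<And>t. \<bar>\<xi> t - p m\<bar> \<le> \<bar>t * v m\<bar>"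
      "\<And>t. g t (p m + t * v m) - g t (p m) = t * v m * partial_deriv m F ((A m t)(m := \<xi> t))"
      by (metis add_diff_cancel_left')
    have \<xi>_lim: "(\<xi> \<longlongrightarrow> p m) (at 0)"
    proof -
      have "((\<lambda>t. \<bar>t * v m\<bar>) \<longlongrightarrow> 0) (at 0)"
        by (rule tendsto_eq_intros refl | simp)+
      then have "((\<lambda>t. \<xi> t - p m) \<longlongrightarrow> 0) (at 0)"
        by (rule Lim_null_comparison[rotated]) (use \<xi>(1) in simp)
      then show ?thesis
        by (simp add: LIM_zero_iff)
    qed
    have lim: "((\<lambda>t. (A m t)(m := \<xi> t)) \<longlongrightarrow> p) (at 0)"
    proof (rule tendsto_fun_coordinatewise)
      fix i
      consider "i = m" | "i < m" | "i > m" by linarith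
      then show "((\<lambda>t. ((A m t)(m := \<xi> t)) i) \<longlongrightarrow> p i) (at 0)"
      proof cases
        case 1
        then show ?thesis using \<xi>_lim by simp
      next
        case 2
        have "((\<lambda>t. p i + t * v i) \<longlongrightarrow> p i) (at 0)"
          by (rule tendsto_eq_intros refl | simp)+
        with 2 show ?thesis by (simp add: A_def)
      next
        case 3
        then show ?thesis by (simp add: A_def)
      qed
    qed
    have "((\<lambda>t. partial_deriv m F ((A m t)(m := \<xi> t))) \<longlongrightarrow> partial_deriv m F p) (at 0)"
    proof (rule continuous_on_tendsto_compose[OF _ lim p])
      show "continuous_on (Espace k) (partial_deriv m F)"
        using Ck_on_continuous[OF openin_Espace Ck_on_partial[OF F]] Suc.prems by simp
      show "\<forall>\<^sub>F t in at 0. (A m t)(m := \<xi> t) \<in> Espace k"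
        using Suc.prems by (intro always_eventually allI fun_upd_in_Espace A_in) auto
    qed
    then have "((\<lambda>t. v m * partial_deriv m F ((A m t)(m := \<xi> t))) \<longlongrightarrow> v m * partial_deriv m F p) (at 0)"
      by (intro tendsto_intros)
    moreover have "\<forall>\<^sub>F t in at 0. v m * partial_deriv m F ((A m t)(m := \<xi> t)) =
        ((F (A (Suc m) t) - F (A m t)) - (F (A (Suc m) 0) - F (A m 0))) / (t - 0)"
    proof -
      have "F (A (Suc m) t) - F (A m t) = t * v m * partial_deriv m F ((A m t)(m := \<xi> t))" for t
        using \<xi>(2)[of t] A_Suc[of t] by (simp add: g_def)
      moreover have "A (Suc m) 0 = A m 0"
        by (auto simp: A_def)
      ultimately show ?thesis
        by (auto simp: eventually_at_filter)
    qed
    ultimately have "((\<lambda>t. F (A (Suc m) t) - F (A m t)) has_real_derivative v m * partial_deriv m F p) (at 0)"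
      unfolding has_field_derivative_iff by (rule Lim_transform_eventually)
    from DERIV_add[OF this Suc.IH] show ?case
      using Suc.prems by (simp add: add.commute mult.commute)
  qed
  from this[OF order_refl] show ?thesis
  proof (rule back_subst[where P = "\<lambda>f. (f has_real_derivative _) _"])
    show "(\<lambda>t. F (A k t)) = (\<lambda>t. F (\<lambda>i. if i < k then p i + t * v i else 0))"
      using p by (intro ext arg_cong[where f = F]) (auto simp: A_def topspace_Euclidean_space)
  qed
qed

text \<open>Schwarz's theorem. The second difference \<open>\<Delta>\<close> is symmetric in i and
  j; two applications of the mean value theorem, in direction i and then j, write it as h^2 times a
  mixed derivative at a point close to p. By continuity \<open>\<Delta> i j h / h\<^sup>2\<close>
  tends to that mixed derivative at p, and exchanging i and j gives the other one.\<close>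

lemma partial_deriv_commute:
  assumes F: "Ck_on (Suc (Suc 0)) k (Espace k) F" and p: "p \<in> Espace k" and i: "i < k" and j: "j < k"
  shows "partial_deriv i (partial_deriv j F) p = partial_deriv j (partial_deriv i F) p"
proof (cases "i = j")
  case False
  define \<Delta> where "\<Delta> i j h = F (p(i := p i + h, j := p j + h)) - F (p(i := p i + h)) -
    F (p(j := p j + h)) + F p" for i j h
  have lim: "((\<lambda>h. \<Delta> i j h / h\<^sup>2) \<longlongrightarrow> partial_deriv j (partial_deriv i F) p) (at 0)"
    if i: "i < k" and j: "j < k" and "i \<noteq> j" for i j
  proof -
    have F': "Ck_on (Suc 0) k (Espace k) (partial_deriv i F)"
      using Ck_on_partial[OF F i] .
    have "\<exists>a b. \<bar>a - p i\<bar> \<le> \<bar>h\<bar> \<and> \<bar>b - p j\<bar> \<le> \<bar>h\<bar> \<and>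
        \<Delta> i j h = h\<^sup>2 * partial_deriv j (partial_deriv i F) (p(i := a, j := b))" for h
    proof -
      have "((\<lambda>s. F (p(j := p j + h, i := s)) - F (p(i := s))) has_real_derivative
          partial_deriv i F (p(j := p j + h, i := s)) - partial_deriv i F (p(i := s))) (at s)" for s
        by (intro DERIV_diff Ck_on_deriv_at[OF F] fun_upd_in_Espace p i j)
      from mean_value_abs[of "\<lambda>s. F (p(j := p j + h, i := s)) - F (p(i := s))", OF this, of "p i" "p i + h"]
      obtain a where a: "\<bar>a - p i\<bar> \<le> \<bar>h\<bar>"
        "(F (p(j := p j + h, i := p i + h)) - F (p(i := p i + h))) - (F (p(j := p j + h, i := p i)) - F (p(i := p i)))
         = h * (partial_deriv i F (p(j := p j + h, i := a)) - partial_deriv i F (p(i := a)))"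
        by auto
      have "((\<lambda>s. partial_deriv i F (p(i := a, j := s))) has_real_derivative
          partial_deriv j (partial_deriv i F) (p(i := a, j := s))) (at s)" for s
        by (intro DERIV_diff Ck_on_deriv_at[OF F'] fun_upd_in_Espace p i j)
      from mean_value_abs[of "\<lambda>s. partial_deriv i F (p(i := a, j := s))", OF this, of "p j" "p j + h"]
      obtain b where b: "\<bar>b - p j\<bar> \<le> \<bar>h\<bar>"
        "partial_deriv i F (p(i := a, j := p j + h)) - partial_deriv i F (p(i := a, j := p j))
         = h * partial_deriv j (partial_deriv i F) (p(i := a, j := b))"
        by auto
      have 1: "p(j := p j + h, i := c) = p(i := c, j := p j + h)" "p(i := c, j := p j) = p(i := c)" for c
        using \<open>i \<noteq> j\<close> by (auto simp: fun_eq_iff)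
      have 2: "p(i := p i, j := p j + h) = p(j := p j + h)"
        by auto
      show ?thesis
        using a b by (intro exI[of _ a] exI[of _ b]) (simp add: \<Delta>_def 1 2 power2_eq_square)
    qed
    then obtain a b where ab: "\<And>h. \<bar>a h - p i\<bar> \<le> \<bar>h\<bar>" "\<And>h. \<bar>b h - p j\<bar> \<le> \<bar>h\<bar>"
      "\<And>h. \<Delta> i j h = h\<^sup>2 * partial_deriv j (partial_deriv i F) (p(i := a h, j := b h))"
      by metis
    have to: "(c \<longlongrightarrow> q) (at 0)" if "\<And>h. \<bar>c h - q\<bar> \<le> \<bar>h\<bar>" for c :: "real \<Rightarrow> real" and q
    proof -
      have "((\<lambda>h::real. \<bar>h\<bar>) \<longlongrightarrow> 0) (at 0)"
        by (rule tendsto_eq_intros refl | simp)+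
      then have "((\<lambda>h. c h - q) \<longlongrightarrow> 0) (at 0)"
        by (rule Lim_null_comparison[rotated]) (use that in simp)
      then show ?thesis
        by (simp add: LIM_zero_iff)
    qed
    have "((\<lambda>h. p(i := a h, j := b h)) \<longlongrightarrow> p) (at 0)"
    proof (rule tendsto_fun_coordinatewise)
      fix l
      show "((\<lambda>h. (p(i := a h, j := b h)) l) \<longlongrightarrow> p l) (at 0)"
        using to[OF ab(1)] to[OF ab(2)] by (cases "l = j"; cases "l = i") auto
    qed
    then have "((\<lambda>h. partial_deriv j (partial_deriv i F) (p(i := a h, j := b h))) \<longlongrightarrow>
        partial_deriv j (partial_deriv i F) p) (at 0)"
    proof (rule continuous_on_tendsto_compose[rotated])
      show "continuous_on (Espace k) (partial_deriv j (partial_deriv i F))"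
        using Ck_on_continuous[OF openin_Espace Ck_on_partial[OF F' j]] .
      show "\<forall>\<^sub>F h in at 0. p(i := a h, j := b h) \<in> Espace k"
        by (intro always_eventually allI fun_upd_in_Espace p i j)
    qed (use p in auto)
    then show ?thesis
      by (rule Lim_transform_eventually) (auto simp: ab(3) eventually_at_filter)
  qed
  have "\<Delta> i j = \<Delta> j i"
    using False by (simp add: \<Delta>_def fun_eq_iff[of "\<Delta> i j"] fun_upd_twist[OF False])
  then show ?thesis
    using lim[OF i j False] lim[OF j i] False by (metis tendsto_unique trivial_limit_at)
qed simp

lemma smooth_on_continuous: "openin (Euclidean_space d) U \<Longrightarrow> smooth_on d U F \<Longrightarrow> continuous_on U F"
  using Ck_on_continuous smooth_on_def by blast

lemma smooth_on_partial: "smooth_on d U F \<Longrightarrow> i < d \<Longrightarrow> smooth_on d U (partial_deriv i F)"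
  unfolding smooth_on_def using Ck_on_partial by blast

lemma partial_deriv_add:
  assumes "smooth_on d U F" "smooth_on d U G" "i < d" "x \<in> U"
  shows "partial_deriv i (\<lambda>x. F x + G x) x = partial_deriv i F x + partial_deriv i G x"
proof -
  have *: "Ck_on (Suc 0) d U F" "Ck_on (Suc 0) d U G"
    using assms(1,2) unfolding smooth_on_def by blast+
  show ?thesis
    unfolding partial_deriv_def[of i "\<lambda>x. F x + G x"]
    by (intro DERIV_imp_deriv DERIV_add Ck_on_deriv[OF *(1) assms(3,4)] Ck_on_deriv[OF *(2) assms(3,4)])
qed

lemma partial_deriv_mult:
  assumes "smooth_on d U F" "smooth_on d U G" "i < d" "x \<in> U"
  shows "partial_deriv i (\<lambda>x. F x * G x) x = partial_deriv i F x * G x + F x * partial_deriv i G x"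
proof -
  have *: "Ck_on (Suc 0) d U F" "Ck_on (Suc 0) d U G"
    using assms(1,2) unfolding smooth_on_def by blast+
  show ?thesis
    using DERIV_mult[OF Ck_on_deriv[OF *(1) assms(3,4)] Ck_on_deriv[OF *(2) assms(3,4)]]
    by (simp add: partial_deriv_def DERIV_imp_deriv mult.commute)
qed

section \<open>Smooth functions, vector fields and probability measures\<close>

text \<open>Compactness makes smooth functions bounded, hence integrable for every Borel probability
  measure.\<close>

locale closed_manifold =
  fixes M :: "('a::{t2_space, second_countable_topology}) manifold"
  assumes manifold: "smooth_manifold M" and compact_UNIV: "compact (UNIV :: 'a set)"
begin

section \<open>Smooth functions on a closed manifold\<close>

lemma chart_is_chart: "c \<in> charts M \<Longrightarrow> is_chart (mdim M) c"
  using manifold by (auto simp: smooth_manifold_def smooth_atlas_def)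

lemma openin_chart: "(U, \<phi>) \<in> charts M \<Longrightarrow> openin (Euclidean_space (mdim M)) (\<phi> ` U)"
  using chart_is_chart[of "(U, \<phi>)"] by (simp add: is_chart_def)

lemma smooth_funs_const: "(\<lambda>x. c) \<in> smooth_funs M"
  by (auto simp: smooth_funs_def smooth_on_def intro: Ck_on_const[OF openin_chart])

lemma smooth_funs_add: "f \<in> smooth_funs M \<Longrightarrow> h \<in> smooth_funs M \<Longrightarrow> (\<lambda>x. f x + h x) \<in> smooth_funs M"
  by (fastforce simp: smooth_funs_def smooth_on_def intro: Ck_on_add[OF openin_chart])

lemma smooth_funs_mult: "f \<in> smooth_funs M \<Longrightarrow> h \<in> smooth_funs M \<Longrightarrow> (\<lambda>x. f x * h x) \<in> smooth_funs M"
  by (fastforce simp: smooth_funs_def smooth_on_def intro: Ck_on_mult[OF openin_chart])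

lemma smooth_funs_cmult: "f \<in> smooth_funs M \<Longrightarrow> (\<lambda>x. c * f x) \<in> smooth_funs M"
  by (rule smooth_funs_mult[OF smooth_funs_const])

lemma smooth_funs_diff:
  assumes "f \<in> smooth_funs M" "h \<in> smooth_funs M"
  shows "(\<lambda>x. f x - h x) \<in> smooth_funs M"
  using smooth_funs_add[OF assms(1) smooth_funs_cmult[OF assms(2), of "- 1"]] by simp

lemma smooth_funs_inverse:
  "f \<in> smooth_funs M \<Longrightarrow> (\<And>x. f x \<noteq> 0) \<Longrightarrow> (\<lambda>x. inverse (f x)) \<in> smooth_funs M"
  by (fastforce simp: smooth_funs_def smooth_on_def intro: Ck_on_inverse[OF openin_chart])

lemma smooth_funs_sum:
  "(\<And>i. i \<in> I \<Longrightarrow> f i \<in> smooth_funs M) \<Longrightarrow> (\<lambda>x. \<Sum>i\<in>I. f i x) \<in> smooth_funs M"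
  by (induction I rule: infinite_finite_induct) (auto intro: smooth_funs_const smooth_funs_add)

text \<open>Smoothness speaks of f only in coordinates. A chart domain is open and the chart is
  continuous on it, so f is the composition of two continuous maps near each point.\<close>

lemma smooth_fun_continuous:
  assumes "f \<in> smooth_funs M"
  shows "continuous_on UNIV f"
proof -
  have "isCont f x" for x
  proof -
    have "x \<in> (\<Union>c\<in>charts M. fst c)"
      using manifold by (simp add: smooth_manifold_def smooth_atlas_def)
    then obtain U \<phi> where c: "(U, \<phi>) \<in> charts M" "x \<in> U"
      by auto
    have U: "open U" and h: "homeomorphic_map (top_of_set U) (subtopology (Euclidean_space (mdim M)) (\<phi> ` U)) \<phi>"
      using chart_is_chart[OF c(1)] by (auto simp: is_chart_def)
    have sub: "\<phi> ` U \<subseteq> Espace (mdim M)"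
      using openin_chart[OF c(1)] by (rule openin_subset)
    have inj: "inj_on \<phi> U"
      using homeomorphic_imp_injective_map[OF h] by simp
    have "continuous_map (top_of_set U) (powertop_real UNIV) \<phi>"
      using homeomorphic_imp_continuous_map[OF h]
      by (simp add: Euclidean_space_def continuous_map_in_subtopology)
    then have \<phi>: "continuous_on U \<phi>"
      by (simp add: euclidean_product_topology)
    have g: "continuous_on (\<phi> ` U) (\<lambda>y. f (inv_into U \<phi> y))"
      using assms c by (intro smooth_on_continuous[OF openin_chart]) (auto simp: smooth_funs_def)
    have "continuous_on U (\<lambda>x. f (inv_into U \<phi> (\<phi> x)))"
      by (rule continuous_on_compose2[OF g \<phi>]) simp
    then have "continuous_on U f"
      by (simp add: inj cong: continuous_on_cong)
    then show ?thesis
      using U c(2) by (simp add: continuous_on_eq_continuous_at)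
  qed
  then show ?thesis
    by (simp add: continuous_on_eq_continuous_at)
qed

lemma smooth_fun_measurable: "f \<in> smooth_funs M \<Longrightarrow> f \<in> borel_measurable borel"
  by (rule borel_measurable_continuous_onI[OF smooth_fun_continuous])

lemma smooth_fun_bounded:
  assumes "f \<in> smooth_funs M"
  obtains B where "\<And>x. \<bar>f x\<bar> \<le> B"
  using compact_imp_bounded[OF compact_continuous_image[OF smooth_fun_continuous[OF assms] compact_UNIV]]
  by (auto simp: bounded_iff)

section \<open>Tangent vectors, vector fields and the Lie bracket\<close>

lemma tangent_vector_add:
  "v \<in> tangent_space M x \<Longrightarrow> f \<in> smooth_funs M \<Longrightarrow> h \<in> smooth_funs M \<Longrightarrow> v (\<lambda>y. f y + h y) = v f + v h"
  by (simp add: tangent_space_def)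

lemma tangent_vector_cmult:
  "v \<in> tangent_space M x \<Longrightarrow> f \<in> smooth_funs M \<Longrightarrow> v (\<lambda>y. c * f y) = c * v f"
  by (simp add: tangent_space_def)

lemma tangent_vector_mult:
  "v \<in> tangent_space M x \<Longrightarrow> f \<in> smooth_funs M \<Longrightarrow> h \<in> smooth_funs M \<Longrightarrow>
   v (\<lambda>y. f y * h y) = v f * h x + f x * v h"
  by (simp add: tangent_space_def)

lemma tangent_vector_nonsmooth: "v \<in> tangent_space M x \<Longrightarrow> f \<notin> smooth_funs M \<Longrightarrow> v f = 0"
  by (simp add: tangent_space_def)

lemma tangent_vector_const: 
  assumes "v \<in> tangent_space M x"
  shows "v (\<lambda>y. c) = 0"
proof -
  have "v (\<lambda>y. 1 * 1) = v (\<lambda>y. 1) + v (\<lambda>y. 1)"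
    by (subst tangent_vector_mult[OF assms smooth_funs_const smooth_funs_const]) simp
  then have "v (\<lambda>y. 1) = 0"
    by simp
  then show ?thesis
    using tangent_vector_cmult[OF assms smooth_funs_const, of c 1] by simp
qed

lemma tangent_vector_diff:
  assumes "v \<in> tangent_space M x" "f \<in> smooth_funs M" "h \<in> smooth_funs M"
  shows "v (\<lambda>y. f y - h y) = v f - v h"
  using tangent_vector_add[OF assms(1,2) smooth_funs_cmult[OF assms(3)], of "- 1"]
    tangent_vector_cmult[OF assms(1,3), of "- 1"] by simp

lemma tangent_vector_sum:
  assumes "v \<in> tangent_space M x"
  shows "(\<And>i. i \<in> I \<Longrightarrow> f i \<in> smooth_funs M) \<Longrightarrow> v (\<lambda>y. \<Sum>i\<in>I. f i y) = (\<Sum>i\<in>I. v (f i))"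
proof (induction I rule: infinite_finite_induct)
  case (insert i I)
  then show ?case
    by (simp add: tangent_vector_add[OF assms _ smooth_funs_sum])
qed (simp_all add: tangent_vector_const[OF assms])

lemma tangent_space_lincomb:
  assumes "\<And>i. i \<in> I \<Longrightarrow> v i \<in> tangent_space M x"
  shows "(\<lambda>f. \<Sum>i\<in>I. c i * v i f) \<in> tangent_space M x"
  unfolding tangent_space_def
proof (intro CollectI conjI ballI allI impI)
  fix f h assume "f \<in> smooth_funs M" "h \<in> smooth_funs M"
  then show "(\<Sum>i\<in>I. c i * v i (\<lambda>y. f y + h y)) = (\<Sum>i\<in>I. c i * v i f) + (\<Sum>i\<in>I. c i * v i h)"
    and "(\<Sum>i\<in>I. c i * v i (\<lambda>y. f y * h y)) =
      (\<Sum>i\<in>I. c i * v i f) * h x + f x * (\<Sum>i\<in>I. c i * v i h)"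
    by (simp_all add: tangent_vector_add[OF assms] tangent_vector_mult[OF assms] algebra_simps
        sum.distrib sum_distrib_left)
next
  fix f and a :: real assume "f \<in> smooth_funs M"
  then show "(\<Sum>i\<in>I. c i * v i (\<lambda>y. a * f y)) = a * (\<Sum>i\<in>I. c i * v i f)"
    by (simp add: tangent_vector_cmult[OF assms] algebra_simps sum_distrib_left)
next
  fix f assume "f \<notin> smooth_funs M"
  then show "(\<Sum>i\<in>I. c i * v i f) = 0"
    by (simp add: tangent_vector_nonsmooth[OF assms])
qed

lemma vector_field_tangent: "w \<in> vector_fields M \<Longrightarrow> w x \<in> tangent_space M x"
  by (simp add: vector_fields_def)

text \<open>The convention that tangent vectors vanish on non-smooth functions makes this true for
  every f, which removes many side conditions below.\<close>

lemma vector_field_smooth: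
  assumes "w \<in> vector_fields M"
  shows "(\<lambda>x. w x f) \<in> smooth_funs M"
proof (cases "f \<in> smooth_funs M")
  case False
  then have "(\<lambda>x. w x f) = (\<lambda>x. 0)"
    using tangent_vector_nonsmooth[OF vector_field_tangent[OF assms]] by auto
  then show ?thesis
    by (simp add: smooth_funs_const)
qed (use assms in \<open>simp add: vector_fields_def\<close>)

lemma vector_fields_lincomb:
  assumes "\<And>i. i \<in> I \<Longrightarrow> w i \<in> vector_fields M"
  shows "(\<lambda>x f. \<Sum>i\<in>I. c i * w i x f) \<in> vector_fields M"
  unfolding vector_fields_def
proof (intro CollectI conjI ballI allI)
  show "(\<lambda>f. \<Sum>i\<in>I. c i * w i x f) \<in> tangent_space M x" for x
    by (intro tangent_space_lincomb vector_field_tangent assms)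
  show "(\<lambda>x. \<Sum>i\<in>I. c i * w i x f) \<in> smooth_funs M" for f
    by (intro smooth_funs_sum smooth_funs_cmult vector_field_smooth assms)
qed

lemma vf_add_in: "w \<in> vector_fields M \<Longrightarrow> z \<in> vector_fields M \<Longrightarrow> vf_add w z \<in> vector_fields M"
  using vector_fields_lincomb[of "UNIV :: bool set" "\<lambda>b. if b then w else z" "\<lambda>b. 1"]
  by (simp add: vf_add_def UNIV_bool add.commute)

lemma vf_cmult_in: "w \<in> vector_fields M \<Longrightarrow> vf_mult (\<lambda>x. c) w \<in> vector_fields M"
  using vector_fields_lincomb[of "{()}" "\<lambda>b. w" "\<lambda>b. c"] by (simp add: vf_mult_def)

lemma vf_zero_in: "(\<lambda>x f. 0) \<in> vector_fields M"
  using vector_fields_lincomb[of "{}"] by simp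

lemma lie_bracket_in:
  assumes "w \<in> vector_fields M" "z \<in> vector_fields M"
  shows "lie_bracket w z \<in> vector_fields M"
  unfolding vector_fields_def
proof (intro CollectI conjI ballI allI)
  note tv = vector_field_tangent[OF assms(1)] vector_field_tangent[OF assms(2)]
  note sm = vector_field_smooth[OF assms(1)] vector_field_smooth[OF assms(2)]
  show "(\<lambda>x. lie_bracket w z x f) \<in> smooth_funs M" for f
    unfolding lie_bracket_def by (intro smooth_funs_diff sm)
  show "lie_bracket w z x \<in> tangent_space M x" for x
    unfolding tangent_space_def
  proof (intro CollectI conjI ballI allI impI)
    fix f h assume [simp]: "f \<in> smooth_funs M" "h \<in> smooth_funs M"
    show "lie_bracket w z x (\<lambda>y. f y + h y) = lie_bracket w z x f + lie_bracket w z x h"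
      by (simp add: lie_bracket_def tangent_vector_add[OF tv(1)] tangent_vector_add[OF tv(2)] sm)
    \<comment> \<open>Both compositions produce the same cross terms \<open>w x f * z x h\<close>
      and \<open>z x f * w x h\<close>, so they cancel in the commutator.\<close>
    show "lie_bracket w z x (\<lambda>y. f y * h y) = lie_bracket w z x f * h x + f x * lie_bracket w z x h"
      by (simp add: lie_bracket_def tangent_vector_add[OF tv(1)] tangent_vector_add[OF tv(2)]
          tangent_vector_mult[OF tv(1)] tangent_vector_mult[OF tv(2)] sm smooth_funs_mult algebra_simps)
  next
    fix f and c :: real assume [simp]: "f \<in> smooth_funs M"
    show "lie_bracket w z x (\<lambda>y. c * f y) = c * lie_bracket w z x f"
      by (simp add: lie_bracket_def tangent_vector_cmult[OF tv(1)] tangent_vector_cmult[OF tv(2)] sm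
          algebra_simps)
  next
    \<comment> \<open>The inner functions are then constantly 0, and tangent vectors annihilate
      constants.\<close>
    fix f assume "f \<notin> smooth_funs M"
    then show "lie_bracket w z x f = 0"
      by (simp add: lie_bracket_def tangent_vector_nonsmooth[OF tv(1)] tangent_vector_nonsmooth[OF tv(2)]
          tangent_vector_const[OF tv(1)] tangent_vector_const[OF tv(2)])
  qed
qed

end

section \<open>Borel probability measures and mixtures with a point mass\<close>

lemma prob_space_measure_of_prob: "prob_space (measure_of_prob \<mu>)"
  and sets_measure_of_prob [simp, measurable_cong]: "sets (measure_of_prob \<mu>) = sets borel"
  using measure_of_prob[of \<mu>] by auto

lemma space_measure_of_prob [simp]: "space (measure_of_prob \<mu>) = UNIV"
  using sets_eq_imp_space_eq[OF sets_measure_of_prob[of \<mu>]] by simp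

lemma integrable_measure_of_prob:
  fixes f :: "'a::topological_space \<Rightarrow> real"
  assumes "f \<in> borel_measurable borel" "\<And>x. \<bar>f x\<bar> \<le> B"
  shows "integrable (measure_of_prob \<mu>) f"
proof -
  interpret prob_space "measure_of_prob \<mu>" by (rule prob_space_measure_of_prob)
  show ?thesis
    by (rule integrable_const_bound[where B = B]) (use assms in auto)
qed

text \<open>The mixture is drawn in two stages: a Bernoulli variable with parameter t selects the
  point mass at x or \<mu>, so it is a probability measure because a bind of such measures is one.
  All bounded Borel f are covered because both smooth functions and the indicator of {x} will be
  inserted.\<close>

lemma borel_prob_mixture:
  fixes \<mu> :: "('a::topological_space) borel_prob" and t :: real
  assumes t: "0 \<le> t" "t \<le> 1"
  obtains \<nu> :: "'a borel_prob" where
    "\<And>(f :: 'a \<Rightarrow> real) B. f \<in> borel_measurable borel \<Longrightarrow> (\<And>y. \<bar>f y\<bar> \<le> B) \<Longrightarrow>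
      (\<integral>y. f y \<partial>measure_of_prob \<nu>) = (1 - t) * (\<integral>y. f y \<partial>measure_of_prob \<mu>) + t * f x"
proof
  define K where "K b = (if b then return borel x else measure_of_prob \<mu>)" for b
  have K: "prob_space (K b)" "sets (K b) = sets borel" for b
    by (auto simp: K_def prob_space_measure_of_prob intro: prob_space_return)
  have K_measurable [measurable]: "K \<in> measurable (measure_pmf (bernoulli_pmf t)) (subprob_algebra borel)"
    using K by (auto simp: space_subprob_algebra prob_space_imp_subprob_space)
  define N where "N = measure_pmf (bernoulli_pmf t) \<bind> K"
  have "prob_space N"
    unfolding N_def by (rule measure_pmf.prob_space_bind[OF _ K_measurable]) (simp add: K)
  moreover have "sets N = sets borel"
    unfolding N_def by (rule sets_bind) (auto simp: K)
  ultimately have N: "measure_of_prob (Borel_Prob N) = N"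
    by (simp add: Borel_Prob_inverse)
  fix f :: "'a \<Rightarrow> real" and B
  assume f [measurable]: "f \<in> borel_measurable borel" and B: "\<And>y. \<bar>f y\<bar> \<le> B"
  have "(\<integral>y. f y \<partial>N) = (\<integral>b. (\<integral>y. f y \<partial>K b) \<partial>measure_pmf (bernoulli_pmf t))"
    unfolding N_def
  proof (rule integral_bind[where K = borel and B = B and B' = 1])
    show "AE b in measure_pmf (bernoulli_pmf t). emeasure (K b) (space (K b)) \<le> ennreal 1"
      using K(1) by (simp add: prob_space.emeasure_space_1)
  qed (rule f B K_measurable measure_pmf.finite_measure_axioms)+
  also have "\<dots> = (1 - t) * (\<integral>y. f y \<partial>measure_of_prob \<mu>) + t * f x"
    using t by (simp add: K_def integral_return)
  finally show "(\<integral>y. f y \<partial>measure_of_prob (Borel_Prob N)) = (1 - t) * (\<integral>y. f y \<partial>measure_of_prob \<mu>) + t * f x"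
    by (simp add: N)
qed

context closed_manifold begin

lemma smooth_fun_integrable: "f \<in> smooth_funs M \<Longrightarrow> integrable (measure_of_prob \<mu>) f"
  by (rule smooth_fun_bounded) (auto intro: integrable_measure_of_prob smooth_fun_measurable)

lemma star_mixture:
  fixes \<mu> :: "'a borel_prob"
  assumes t: "0 \<le> t" "t \<le> 1"
  obtains \<nu> :: "'a borel_prob" where
    "\<And>f. f \<in> smooth_funs M \<Longrightarrow> star f \<nu> = (1 - t) * star f \<mu> + t * f x"
    "t \<le> measure (measure_of_prob \<nu>) {x}"
proof -
  obtain \<nu> where \<nu>: "\<And>f B. f \<in> borel_measurable borel \<Longrightarrow> (\<And>y. \<bar>f y\<bar> \<le> B) \<Longrightarrow>
      (\<integral>y. f y \<partial>measure_of_prob \<nu>) = (1 - t) * (\<integral>y. f y \<partial>measure_of_prob \<mu>) + t * (f x :: real)"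
    using borel_prob_mixture[OF t, of \<mu> x] by metis
  have "star f \<nu> = (1 - t) * star f \<mu> + t * f x" if "f \<in> smooth_funs M" for f
    using smooth_fun_bounded[OF that] \<nu>[OF smooth_fun_measurable[OF that]] unfolding star_def by metis
  moreover have "t \<le> measure (measure_of_prob \<nu>) {x}"
  proof -
    have "(1 - t) * measure (measure_of_prob \<mu>) {x} + t = measure (measure_of_prob \<nu>) {x}"
      using \<nu>[of "indicator {x}" 1] by (simp add: indicator_le_1)
    moreover have "0 \<le> (1 - t) * measure (measure_of_prob \<mu>) {x}"
      using t by simp
    ultimately show ?thesis
      by linarith
  qed
  ultimately show ?thesis
    using that by blast
qed

end

section \<open>Cylinder functions\<close>

text \<open>Mixtures exist only for t between 0 and 1, so two representations of a cylinder function
  can be compared only to the right of 0, although each of the two expressions is differentiable at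
  0 from both sides.\<close>

lemma right_deriv_unique:
  fixes a b :: "real \<Rightarrow> real"
  assumes "(a has_real_derivative D) (at 0)" "(b has_real_derivative E) (at 0)"
    and eq: "\<And>t. 0 \<le> t \<Longrightarrow> t \<le> 1 \<Longrightarrow> a t = b t"
  shows "D = E"
proof -
  note a = has_field_derivative_at_within[OF assms(1), of "{0<..}", unfolded has_field_derivative_iff]
  note b = has_field_derivative_at_within[OF assms(2), of "{0<..}", unfolded has_field_derivative_iff]
  have "\<forall>\<^sub>F t in at_right 0. (a t - a 0) / (t - 0) = (b t - b 0) / (t - 0)"
    by (rule eventually_at_rightI[of 0 1]) (simp_all add: eq)
  from Lim_transform_eventually[OF a this] show ?thesis
    by (rule tendsto_unique[OF trivial_limit_at_right_real _ b])
qed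

text \<open>The derivative in a direction w that does not vary with \<mu>. In \<open>act\<close> the
  direction moves with the measure; separating the two lets u be differentiated in \<mu> while the
  direction is held still.\<close>

definition dir_deriv ::
  "('a::topological_space) manifold \<Rightarrow> 'a vfield \<Rightarrow> 'a cylfun \<Rightarrow> 'a cylfun" where
  "dir_deriv M w u \<mu> = (\<integral>x. differential M u \<mu> x (w x) \<partial>measure_of_prob \<mu>)"

lemma act_eq_dir_deriv: "act M V u \<mu> = dir_deriv M (cyl_at V \<mu>) u \<mu>"
  by (simp add: act_def dir_deriv_def)

lemma star_vec_in_Espace: "star_vec k f \<mu> \<in> Espace k"
  by (simp add: star_vec_def topspace_Euclidean_space)

lemma star_vec_nth [simp]: "i < k \<Longrightarrow> star_vec k f \<mu> i = star (f i) \<mu>"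
  by (simp add: star_vec_def)

lemma represents_Ck: "represents M k F f u \<Longrightarrow> Ck_on n k (Espace k) F"
  by (simp add: represents_def smooth_on_def)

lemma represents_smooth: "represents M k F f u \<Longrightarrow> i < k \<Longrightarrow> f i \<in> smooth_funs M"
  by (simp add: represents_def)

lemma represents_eq: "represents M k F f u \<Longrightarrow> u \<mu> = F (star_vec k f \<mu>)"
  by (simp add: represents_def)

lemma represents_in: "represents M k F f u \<Longrightarrow> u \<in> cylinder_funs M"
  by (auto simp: cylinder_funs_def)

lemma represents_partial:
  assumes "represents M k F f u" "i < k"
  shows "represents M k (partial_deriv i F) f (\<lambda>\<mu>. partial_deriv i F (star_vec k f \<mu>))"
  using assms smooth_on_partial unfolding represents_def by blast

context closed_manifold begin

text \<open>A whole family is fixed at once because limits as t decreases to 0 need a function of t.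
  Outside the unit interval \<open>\<nu>\<close> is arbitrary.\<close>

definition mixes :: "'a borel_prob \<Rightarrow> 'a \<Rightarrow> (real \<Rightarrow> 'a borel_prob) \<Rightarrow> bool" where
  "mixes \<mu> x \<nu> \<longleftrightarrow> (\<forall>t. 0 \<le> t \<longrightarrow> t \<le> 1 \<longrightarrow>
     (\<forall>f\<in>smooth_funs M. star f (\<nu> t) = (1 - t) * star f \<mu> + t * f x) \<and>
     t \<le> measure (measure_of_prob (\<nu> t)) {x})"

lemma ex_mixes: "\<exists>\<nu>. mixes \<mu> x \<nu>"
proof -
  have "\<exists>\<nu>'. 0 \<le> t \<longrightarrow> t \<le> 1 \<longrightarrow>
     (\<forall>f\<in>smooth_funs M. star f \<nu>' = (1 - t) * star f \<mu> + t * f x) \<and>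
     t \<le> measure (measure_of_prob \<nu>') {x}" for t :: real
    using star_mixture[of t \<mu> x] by metis
  then show ?thesis
    unfolding mixes_def by (rule choice[OF allI])
qed

text \<open>In the coordinates of a representation the mixtures run along a straight line. The
  right-hand side makes sense for all real t, so it can be differentiated at 0.\<close>

lemma mixes_represents:
  assumes "mixes \<mu> x \<nu>" "represents M k F f u" "0 \<le> t" "t \<le> 1"
  shows "u (\<nu> t) = F (\<lambda>i. if i < k then star_vec k f \<mu> i + t * (f i x - star (f i) \<mu>) else 0)"
proof -
  have "star (f i) (\<nu> t) = star (f i) \<mu> + t * (f i x - star (f i) \<mu>)" if "i < k" for i
    using assms represents_smooth[OF assms(2) that] by (simp add: mixes_def algebra_simps)
  then have "star_vec k f (\<nu> t) = (\<lambda>i. if i < k then star_vec k f \<mu> i + t * (f i x - star (f i) \<mu>) else 0)"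
    by (auto simp: star_vec_def)
  then show ?thesis
    by (simp add: represents_eq[OF assms(2)])
qed

lemma represents_line_deriv:
  assumes "represents M k F f u"
  shows "((\<lambda>t. F (\<lambda>i. if i < k then star_vec k f \<mu> i + t * (f i x - star (f i) \<mu>) else 0)) has_real_derivative
     (\<Sum>i<k. partial_deriv i F (star_vec k f \<mu>) * (f i x - star (f i) \<mu>))) (at 0)"
  by (rule Ck_on_line_deriv[OF represents_Ck[OF assms] star_vec_in_Espace])

text \<open>Continuity needs no topology on the space of measures: it is read off from the
  representing expression, which is differentiable at t = 0.\<close>

lemma mixes_tendsto:
  assumes "mixes \<mu> x \<nu>" "u \<in> cylinder_funs M"
  shows "((\<lambda>t. u (\<nu> t)) \<longlongrightarrow> u \<mu>) (at_right 0)"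
proof -
  obtain k F f where r: "represents M k F f u"
    using assms(2) by (auto simp: cylinder_funs_def)
  define a where "a t = F (\<lambda>i. if i < k then star_vec k f \<mu> i + t * (f i x - star (f i) \<mu>) else 0)" for t
  have "isCont a 0"
    unfolding a_def by (rule DERIV_isCont[OF represents_line_deriv[OF r]])
  then have "(a \<longlongrightarrow> a 0) (at_right 0)"
    unfolding isCont_def filterlim_at_split by blast
  moreover have "a 0 = u \<mu>"
    unfolding a_def represents_eq[OF r]
    by (rule arg_cong[where f = F]) (auto simp: star_vec_def)
  moreover have "\<forall>\<^sub>F t in at_right 0. a t = u (\<nu> t)"
    by (rule eventually_at_rightI[of 0 1]) (simp_all add: a_def mixes_represents[OF assms(1) r])
  ultimately show ?thesis
    by (simp add: Lim_transform_eventually)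
qed

text \<open>
  Moving \<open>\<mu>\<close> towards the point mass at y, the derivative of u determines the function
  \<open>\<Sum>i. \<partial>\<^sub>iF(f\<^sup>\<star>\<mu>) f\<^sub>i\<close> on M up to an additive constant, hence its differential.
\<close>

lemma differential_represents:
  assumes r: "represents M k F f u"
  shows "differential M u \<mu> = (\<lambda>x v. \<Sum>i<k. partial_deriv i F (star_vec k f \<mu>) * dform M (f i) x v)"
proof -
  define \<omega> where "\<omega> k F f = (\<lambda>x v. \<Sum>i<k. partial_deriv i F (star_vec k f \<mu>) * dform M (f i) x v)" for k F f
  have "\<omega> l G h = \<omega> k F f" if s: "represents M l G h u" for l G h
  proof (intro ext)
    fix x v
    show "\<omega> l G h x v = \<omega> k F f x v"
    proof (cases "v \<in> tangent_space M x")
      case True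
      \<comment> \<open>\<open>\<phi>\<close> is a function on M whose differential is the 1-form,
        and c below is its integral under \<mu>. Moving towards the point mass at y reveals only
        \<open>\<phi> k F f y - c k F f\<close>; the unknown constant does not matter because v
        annihilates it.\<close>
      define \<phi> where "\<phi> k F f y = (\<Sum>i<k. partial_deriv i F (star_vec k f \<mu>) * f i y)"
        for k :: nat and F and f :: "nat \<Rightarrow> 'a \<Rightarrow> real" and y
      define c where "c k F f = (\<Sum>i<k. partial_deriv i F (star_vec k f \<mu>) * star (f i) \<mu>)"
        for k :: nat and F and f :: "nat \<Rightarrow> 'a \<Rightarrow> real"
      have "\<phi> k F f y - c k F f = \<phi> l G h y - c l G h" for y
      proof -
        obtain \<nu> where \<nu>: "mixes \<mu> y \<nu>"
          using ex_mixes by blast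
        have "(\<Sum>i<k. partial_deriv i F (star_vec k f \<mu>) * (f i y - star (f i) \<mu>)) =
          (\<Sum>i<l. partial_deriv i G (star_vec l h \<mu>) * (h i y - star (h i) \<mu>))"
          by (rule right_deriv_unique[OF represents_line_deriv[OF r] represents_line_deriv[OF s]])
            (simp flip: mixes_represents[OF \<nu> r] mixes_represents[OF \<nu> s])
        then show ?thesis
          by (simp add: \<phi>_def c_def algebra_simps sum_subtractf)
      qed
      then have "\<phi> k F f = (\<lambda>y. \<phi> l G h y + (c k F f - c l G h))"
        by (auto simp: algebra_simps)
      moreover have sm: "\<phi> l G h \<in> smooth_funs M"
        unfolding \<phi>_def[abs_def] using represents_smooth[OF s]
        by (intro smooth_funs_sum smooth_funs_cmult) auto
      ultimately have "v (\<phi> k F f) = v (\<phi> l G h)"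
        by (simp add: tangent_vector_add[OF True sm smooth_funs_const] tangent_vector_const[OF True])
      moreover have "\<omega> k F f x v = v (\<phi> k F f)" if "represents M k F f u" for k F f
      proof -
        have "v (\<phi> k F f) = (\<Sum>i<k. v (\<lambda>y. partial_deriv i F (star_vec k f \<mu>) * f i y))"
          unfolding \<phi>_def[abs_def] using represents_smooth[OF that]
          by (intro tangent_vector_sum[OF True] smooth_funs_cmult) auto
        then show ?thesis
          using represents_smooth[OF that] True
          by (simp add: \<omega>_def dform_def tangent_vector_cmult[OF True])
      qed
      ultimately show ?thesis
        using r s by simp
    qed (simp add: \<omega>_def dform_def)
  qed
  then have "(THE \<omega>'. \<exists>k F f. represents M k F f u \<and> \<omega>' = \<omega> k F f) = \<omega> k F f"
    using r by (intro the_equality) blast+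
  then have "differential M u \<mu> = \<omega> k F f"
    by (simp add: differential_def \<omega>_def)
  then show ?thesis
    by (simp add: \<omega>_def)
qed

text \<open>Integration over M is absorbed into the \<open>star\<close> functions. From here on,
  rules for \<open>dir_deriv\<close> are rules for the partial derivatives of F.\<close>

lemma dir_deriv_represents:
  assumes r: "represents M k F f u" and w: "w \<in> vector_fields M"
  shows "dir_deriv M w u \<mu> = (\<Sum>i<k. partial_deriv i F (star_vec k f \<mu>) * star (\<lambda>x. w x (f i)) \<mu>)"
proof -
  have "dir_deriv M w u \<mu> =
      (\<integral>x. (\<Sum>i<k. partial_deriv i F (star_vec k f \<mu>) * w x (f i)) \<partial>measure_of_prob \<mu>)"
    by (simp add: dir_deriv_def differential_represents[OF r] dform_def vector_field_tangent[OF w])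
  also have "\<dots> = (\<Sum>i<k. partial_deriv i F (star_vec k f \<mu>) * star (\<lambda>x. w x (f i)) \<mu>)"
    by (simp add: star_def Bochner_Integration.integral_sum smooth_fun_integrable[OF vector_field_smooth[OF w]])
  finally show ?thesis .
qed

text \<open>The two lists of test functions are concatenated; F reads the first k variables and G
  the following l.\<close>

lemma cylinder_funs_common:
  assumes "u \<in> cylinder_funs M" "v \<in> cylinder_funs M"
  obtains k F G f where "represents M k F f u" "represents M k G f v"
proof -
  obtain k F f l G h where r: "represents M k F f u" and s: "represents M l G h v"
    using assms by (auto simp: cylinder_funs_def)
  define e where "e i = (if i < k then f i else h (i - k))" for i
  define F' where "F' y = F (\<lambda>i. if i < k then y i else 0)" for y
  define G' where "G' y = G (\<lambda>i. if i < l then y (k + i) else 0)" for y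
  have "smooth_on (k + l) (Espace (k + l)) F'"
    unfolding smooth_on_def F'_def[abs_def]
    by (intro allI Ck_on_reindex[OF represents_Ck[OF r]]) auto
  moreover have "smooth_on (k + l) (Espace (k + l)) G'"
    unfolding smooth_on_def G'_def[abs_def]
    by (intro allI Ck_on_reindex[OF represents_Ck[OF s]]) auto
  moreover have "e i \<in> smooth_funs M" if "i < k + l" for i
    using that represents_smooth[OF r] represents_smooth[OF s] by (auto simp: e_def)
  moreover have "(\<lambda>i. if i < k then star_vec (k + l) e \<mu> i else 0) = star_vec k f \<mu>"
    and "(\<lambda>i. if i < l then star_vec (k + l) e \<mu> (k + i) else 0) = star_vec l h \<mu>" for \<mu>
    by (auto simp: star_vec_def e_def)
  ultimately have "represents M (k + l) F' e u" "represents M (k + l) G' e v"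
    using r s unfolding represents_def by (auto simp: F'_def G'_def)
  then show ?thesis
    by (rule that)
qed

section \<open>The algebra of cylinder functions and the rules for directional derivatives\<close>

lemma represents_add:
  assumes "represents M k F f u" "represents M k G f v"
  shows "represents M k (\<lambda>y. F y + G y) f (\<lambda>\<mu>. u \<mu> + v \<mu>)"
  using assms Ck_on_add[OF openin_Espace] unfolding represents_def smooth_on_def by auto

lemma represents_mult:
  assumes "represents M k F f u" "represents M k G f v"
  shows "represents M k (\<lambda>y. F y * G y) f (\<lambda>\<mu>. u \<mu> * v \<mu>)"
  using assms Ck_on_mult[OF openin_Espace] unfolding represents_def smooth_on_def by auto

lemma represents_const: "represents M 0 (\<lambda>y. c) f (\<lambda>\<mu>. c)"
  unfolding represents_def smooth_on_def using Ck_on_const[OF openin_Espace] by auto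

lemma represents_star:
  assumes "f \<in> smooth_funs M"
  shows "represents M 1 (\<lambda>y. y 0) (\<lambda>i. f) (star f)"
  unfolding represents_def smooth_on_def using Ck_on_coordinate[OF openin_Espace] assms by auto

lemma cylinder_funs_add:
  "u \<in> cylinder_funs M \<Longrightarrow> v \<in> cylinder_funs M \<Longrightarrow> (\<lambda>\<mu>. u \<mu> + v \<mu>) \<in> cylinder_funs M"
  by (rule cylinder_funs_common[of u v]) (auto intro: represents_in[OF represents_add])

lemma cylinder_funs_mult:
  "u \<in> cylinder_funs M \<Longrightarrow> v \<in> cylinder_funs M \<Longrightarrow> (\<lambda>\<mu>. u \<mu> * v \<mu>) \<in> cylinder_funs M"
  by (rule cylinder_funs_common[of u v]) (auto intro: represents_in[OF represents_mult])

lemma cylinder_funs_const: "(\<lambda>\<mu>. c) \<in> cylinder_funs M"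
  using represents_const represents_in by blast

lemma cylinder_funs_cmult: "u \<in> cylinder_funs M \<Longrightarrow> (\<lambda>\<mu>. c * u \<mu>) \<in> cylinder_funs M"
  by (rule cylinder_funs_mult[OF cylinder_funs_const])

lemma cylinder_funs_star: "f \<in> smooth_funs M \<Longrightarrow> star f \<in> cylinder_funs M"
  using represents_star represents_in by blast

lemma cylinder_funs_sum:
  "(\<And>i. i \<in> I \<Longrightarrow> u i \<in> cylinder_funs M) \<Longrightarrow> (\<lambda>\<mu>. \<Sum>i\<in>I. u i \<mu>) \<in> cylinder_funs M"
  by (induction I rule: infinite_finite_induct) (auto intro: cylinder_funs_const cylinder_funs_add)

lemma dir_deriv_add:
  assumes "u \<in> cylinder_funs M" "v \<in> cylinder_funs M" and w: "w \<in> vector_fields M"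
  shows "dir_deriv M w (\<lambda>\<mu>. u \<mu> + v \<mu>) \<mu> = dir_deriv M w u \<mu> + dir_deriv M w v \<mu>"
proof -
  obtain k F G f where r: "represents M k F f u" and s: "represents M k G f v"
    using cylinder_funs_common[OF assms(1,2)] .
  have "smooth_on k (Espace k) F" "smooth_on k (Espace k) G"
    using r s by (auto simp: represents_def)
  then show ?thesis
    by (simp add: dir_deriv_represents[OF represents_add[OF r s] w] dir_deriv_represents[OF r w]
        dir_deriv_represents[OF s w] partial_deriv_add[OF _ _ _ star_vec_in_Espace] sum.distrib algebra_simps)
qed

lemma dir_deriv_mult:
  assumes "u \<in> cylinder_funs M" "v \<in> cylinder_funs M" and w: "w \<in> vector_fields M"
  shows "dir_deriv M w (\<lambda>\<mu>. u \<mu> * v \<mu>) \<mu> = dir_deriv M w u \<mu> * v \<mu> + u \<mu> * dir_deriv M w v \<mu>"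
proof -
  obtain k F G f where r: "represents M k F f u" and s: "represents M k G f v"
    using cylinder_funs_common[OF assms(1,2)] .
  have "smooth_on k (Espace k) F" "smooth_on k (Espace k) G"
    using r s by (auto simp: represents_def)
  then show ?thesis
    by (subst dir_deriv_represents[OF represents_mult[OF r s] w]) (simp add: dir_deriv_represents[OF r w]
        dir_deriv_represents[OF s w] partial_deriv_mult[OF _ _ _ star_vec_in_Espace]
        represents_eq[OF r] represents_eq[OF s] sum.distrib algebra_simps sum_distrib_left)
qed

lemma dir_deriv_const: "w \<in> vector_fields M \<Longrightarrow> dir_deriv M w (\<lambda>\<mu>. c) \<mu> = 0"
  using dir_deriv_represents[OF represents_const] by simp

lemma dir_deriv_cmult:
  assumes "u \<in> cylinder_funs M" "w \<in> vector_fields M"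
  shows "dir_deriv M w (\<lambda>\<mu>. c * u \<mu>) \<mu> = c * dir_deriv M w u \<mu>"
  using dir_deriv_mult[OF cylinder_funs_const assms] by (simp add: dir_deriv_const[OF assms(2)])

lemma dir_deriv_star:
  assumes "f \<in> smooth_funs M" "w \<in> vector_fields M"
  shows "dir_deriv M w (star f) \<mu> = star (\<lambda>x. w x f) \<mu>"
  using dir_deriv_represents[OF represents_star[OF assms(1)] assms(2)]
  by (simp add: partial_deriv_def)

lemma dir_deriv_sum:
  assumes w: "w \<in> vector_fields M"
  shows "(\<And>i. i \<in> I \<Longrightarrow> u i \<in> cylinder_funs M) \<Longrightarrow>
    dir_deriv M w (\<lambda>\<mu>. \<Sum>i\<in>I. u i \<mu>) \<mu> = (\<Sum>i\<in>I. dir_deriv M w (u i) \<mu>)"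
proof (induction I rule: infinite_finite_induct)
  case (insert i I)
  then show ?case
    by (simp add: dir_deriv_add[OF _ cylinder_funs_sum w])
qed (simp_all add: dir_deriv_const[OF w])

lemma star_sum:
  assumes "\<And>i. i \<in> I \<Longrightarrow> f i \<in> smooth_funs M"
  shows "star (\<lambda>x. \<Sum>i\<in>I. c i * f i x) \<mu> = (\<Sum>i\<in>I. c i * star (f i) \<mu>)"
  using assms by (simp add: star_def Bochner_Integration.integral_sum smooth_fun_integrable)

lemma star_add:
  "f \<in> smooth_funs M \<Longrightarrow> h \<in> smooth_funs M \<Longrightarrow> star (\<lambda>x. f x + h x) \<mu> = star f \<mu> + star h \<mu>"
  by (simp add: star_def smooth_fun_integrable)

lemma star_diff:
  "f \<in> smooth_funs M \<Longrightarrow> h \<in> smooth_funs M \<Longrightarrow> star (\<lambda>x. f x - h x) \<mu> = star f \<mu> - star h \<mu>"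
  by (simp add: star_def smooth_fun_integrable)

lemma dir_deriv_lincomb:
  assumes u: "u \<in> cylinder_funs M" and w: "\<And>i. i \<in> I \<Longrightarrow> w i \<in> vector_fields M"
  shows "dir_deriv M (\<lambda>x f. \<Sum>i\<in>I. c i * w i x f) u \<mu> = (\<Sum>i\<in>I. c i * dir_deriv M (w i) u \<mu>)"
proof -
  obtain k F f where r: "represents M k F f u"
    using u by (auto simp: cylinder_funs_def)
  have "dir_deriv M (\<lambda>x f. \<Sum>i\<in>I. c i * w i x f) u \<mu> =
    (\<Sum>j<k. \<Sum>i\<in>I. partial_deriv j F (star_vec k f \<mu>) * (c i * star (\<lambda>x. w i x (f j)) \<mu>))"
    by (simp add: dir_deriv_represents[OF r vector_fields_lincomb[OF w]] star_sum vector_field_smooth[OF w]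
        sum_distrib_left)
  also have "\<dots> = (\<Sum>i\<in>I. c i * dir_deriv M (w i) u \<mu>)"
    by (subst sum.swap) (simp add: dir_deriv_represents[OF r w] sum_distrib_left mult_ac)
  finally show ?thesis .
qed

lemma dir_deriv_in:
  assumes "u \<in> cylinder_funs M" "w \<in> vector_fields M"
  shows "dir_deriv M w u \<in> cylinder_funs M"
proof -
  obtain k F f where r: "represents M k F f u"
    using assms(1) by (auto simp: cylinder_funs_def)
  have "(\<lambda>\<mu>. \<Sum>i<k. partial_deriv i F (star_vec k f \<mu>) * star (\<lambda>x. w x (f i)) \<mu>) \<in> cylinder_funs M"
    by (intro cylinder_funs_sum cylinder_funs_mult represents_in[OF represents_partial[OF r]]
        cylinder_funs_star vector_field_smooth[OF assms(2)]) auto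
  then show ?thesis
    by (simp add: dir_deriv_represents[OF r assms(2), abs_def])
qed

end

section \<open>Cylinder vector fields as functions of the measure\<close>

text \<open>The additive map from the free abelian group to the reals that extends \<phi> from the
  generators. Values of cylinder fields are of this kind.\<close>

definition frag_eval :: "('b \<Rightarrow> real) \<Rightarrow> ('b \<Rightarrow>\<^sub>0 int) \<Rightarrow> real" where
  "frag_eval \<phi> a = (\<Sum>p\<in>Poly_Mapping.keys a. of_int (Poly_Mapping.lookup a p) * \<phi> p)"

lemma frag_eval_superset:
  assumes "finite A" "Poly_Mapping.keys a \<subseteq> A"
  shows "frag_eval \<phi> a = (\<Sum>p\<in>A. of_int (Poly_Mapping.lookup a p) * \<phi> p)"
  unfolding frag_eval_def using assms
  by (intro sum.mono_neutral_left) (auto simp: in_keys_iff)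

lemma frag_eval_0 [simp]: "frag_eval \<phi> 0 = 0"
  by (simp add: frag_eval_def)

lemma frag_eval_of [simp]: "frag_eval \<phi> (frag_of p) = \<phi> p"
  by (simp add: frag_eval_def)

lemma frag_eval_add [simp]: "frag_eval \<phi> (a + b) = frag_eval \<phi> a + frag_eval \<phi> b"
proof -
  let ?A = "Poly_Mapping.keys a \<union> Poly_Mapping.keys b"
  have "frag_eval \<phi> c = (\<Sum>p\<in>?A. of_int (Poly_Mapping.lookup c p) * \<phi> p)" if "c \<in> {a, b, a + b}" for c
    using that keys_add[of a b] by (intro frag_eval_superset) auto
  then show ?thesis
    by (simp add: lookup_add sum.distrib algebra_simps)
qed

lemma frag_eval_minus [simp]: "frag_eval \<phi> (- a) = - frag_eval \<phi> a"
  using frag_eval_add[of \<phi> a "- a"] by simp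

lemma frag_eval_diff [simp]: "frag_eval \<phi> (a - b) = frag_eval \<phi> a - frag_eval \<phi> b"
  using frag_eval_add[of \<phi> a "- b"] by simp

lemma frag_eval_sum: "frag_eval \<phi> (\<Sum>i\<in>I. a i) = (\<Sum>i\<in>I. frag_eval \<phi> (a i))"
  by (induction I rule: infinite_finite_induct) auto

lemma frag_eval_extend: "frag_eval \<phi> (frag_extend (\<lambda>p. frag_of (g p)) a) = frag_eval (\<lambda>p. \<phi> (g p)) a"
proof -
  have "Poly_Mapping.keys a \<subseteq> UNIV" by simp
  then show ?thesis
    by (induction a rule: frag_induction) (auto simp: frag_extend_diff)
qed

lemma cyl_at_eq_frag_eval: "cyl_at V \<mu> x f = frag_eval (\<lambda>p. fst p \<mu> * snd p x f) (cyl_rep V)"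
  by (simp add: cyl_at_def frag_eval_def case_prod_beta mult.assoc)

text \<open>Integer coefficients are replaced by repetition, so that the length of the list can
  serve as induction measure when fields are eliminated.\<close>

definition frag_list :: "'b list \<Rightarrow> 'b \<Rightarrow>\<^sub>0 int" where
  "frag_list ps = (\<Sum>p\<leftarrow>ps. frag_of p)"

lemma frag_list_simps [simp]:
  "frag_list [] = 0" "frag_list (p # ps) = frag_of p + frag_list ps"
  "frag_list (ps @ qs) = frag_list ps + frag_list qs"
  by (simp_all add: frag_list_def)

lemma frag_eval_list: "frag_eval \<phi> (frag_list ps) = (\<Sum>p\<leftarrow>ps. \<phi> p)"
  by (induction ps) auto

context closed_manifold begin

abbreviation "pairs \<equiv> cylinder_funs M \<times> vector_fields M"

section \<open>The quotient by the tensor relations\<close>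

lemma keys_frag_list: "set ps \<subseteq> pairs \<Longrightarrow> Poly_Mapping.keys (frag_list ps) \<subseteq> pairs"
proof (induction ps)
  case (Cons p ps)
  then show ?case
    using keys_add[of "frag_of p" "frag_list ps"] by auto
qed simp

lemma keys_diff_subset:
  "Poly_Mapping.keys a \<subseteq> S \<Longrightarrow> Poly_Mapping.keys b \<subseteq> S \<Longrightarrow> Poly_Mapping.keys (a - b) \<subseteq> S"
  by (meson Un_least keys_diff order_trans)

lemma tensor_relators_carrier: "tensor_relators M \<subseteq> carrier (formal_group M)"
proof
  fix a assume "a \<in> tensor_relators M"
  then have "Poly_Mapping.keys a \<subseteq> pairs"
    unfolding tensor_relators_def
    by (elim UnE CollectE exE conjE; hypsubst; intro keys_diff_subset)
      (simp_all add: cylinder_funs_add cylinder_funs_cmult vf_add_in vf_cmult_in)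
  then show "a \<in> carrier (formal_group M)"
    by (simp add: formal_group_def)
qed

lemma comm_group_formal: "comm_group (formal_group M)"
  by (simp add: formal_group_def abelian_free_Abelian_group)

lemma subgroup_tensor_relations: "subgroup (tensor_relations M) (formal_group M)"
  unfolding tensor_relations_def
  by (rule group.generate_is_subgroup[OF _ tensor_relators_carrier]) (simp add: formal_group_def)

lemma normal_tensor_relations: "tensor_relations M \<lhd> formal_group M"
  by (rule comm_group.subgroup_imp_normal[OF comm_group_formal subgroup_tensor_relations])

lemma tensor_relations_keys: "a \<in> tensor_relations M \<Longrightarrow> Poly_Mapping.keys a \<subseteq> pairs"
  using subgroup.mem_carrier[OF subgroup_tensor_relations, of a] by (simp add: formal_group_def)

lemma tensor_relations_0: "0 \<in> tensor_relations M"
  using subgroup.one_closed[OF subgroup_tensor_relations] by (simp add: formal_group_def)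

lemma tensor_relations_add:
  "a \<in> tensor_relations M \<Longrightarrow> b \<in> tensor_relations M \<Longrightarrow> a + b \<in> tensor_relations M"
  using subgroup.m_closed[OF subgroup_tensor_relations, of a b] by (simp add: formal_group_def)

lemma tensor_relations_uminus: "a \<in> tensor_relations M \<Longrightarrow> - a \<in> tensor_relations M"
  using subgroup.m_inv_closed[OF subgroup_tensor_relations, of a] tensor_relations_keys[of a]
  by (simp add: formal_group_def)

lemma tensor_relations_diff:
  "a \<in> tensor_relations M \<Longrightarrow> b \<in> tensor_relations M \<Longrightarrow> a - b \<in> tensor_relations M"
  using tensor_relations_add[OF _ tensor_relations_uminus] by fastforce

lemma tensor_relations_list:
  "(\<And>p. p \<in> set ps \<Longrightarrow> frag_of p \<in> tensor_relations M) \<Longrightarrow> frag_list ps \<in> tensor_relations M"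
  by (induction ps) (auto intro: tensor_relations_0 tensor_relations_add)

lemma tensor_relation_add_fun:
  assumes "u \<in> cylinder_funs M" "u' \<in> cylinder_funs M" "w \<in> vector_fields M"
  shows "frag_of (\<lambda>\<mu>. u \<mu> + u' \<mu>, w) - frag_of (u, w) - frag_of (u', w) \<in> tensor_relations M"
  unfolding tensor_relations_def by (rule generate.incl) (use assms in \<open>auto simp: tensor_relators_def\<close>)

lemma tensor_relation_add_field:
  assumes "u \<in> cylinder_funs M" "w \<in> vector_fields M" "w' \<in> vector_fields M"
  shows "frag_of (u, vf_add w w') - frag_of (u, w) - frag_of (u, w') \<in> tensor_relations M"
  unfolding tensor_relations_def by (rule generate.incl) (use assms in \<open>auto simp: tensor_relators_def\<close>)

lemma tensor_relation_scalar:
  assumes "u \<in> cylinder_funs M" "w \<in> vector_fields M"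
  shows "frag_of (\<lambda>\<mu>. c * u \<mu>, w) - frag_of (u, vf_mult (\<lambda>x. c) w) \<in> tensor_relations M"
  unfolding tensor_relations_def by (rule generate.incl) (use assms in \<open>auto simp: tensor_relators_def\<close>)

text \<open>The additivity relation for 0 + 0 = 0 collapses to the negative of this
  generator.\<close>

lemma tensor_relation_zero_fun:
  assumes "w \<in> vector_fields M"
  shows "frag_of (\<lambda>\<mu>. 0, w) \<in> tensor_relations M"
  using tensor_relations_uminus[OF tensor_relation_add_fun[OF cylinder_funs_const[of 0] cylinder_funs_const[of 0] assms]]
  by simp

lemma tensor_relation_zero_field:
  assumes "u \<in> cylinder_funs M"
  shows "frag_of (u, \<lambda>x f. 0) \<in> tensor_relations M"
  using tensor_relations_uminus[OF tensor_relation_add_field[OF assms vf_zero_in vf_zero_in]]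
  by (simp add: vf_add_def)

lemma tensor_class_eq_iff:
  assumes "Poly_Mapping.keys a \<subseteq> pairs" "Poly_Mapping.keys b \<subseteq> pairs" "a - b \<in> tensor_relations M"
  shows "tensor_class M a = tensor_class M b"
proof -
  have "k + a = (k + (a - b)) + b" "k + b = (k - (a - b)) + a" for k
    by simp_all
  then show ?thesis
    using tensor_relations_add[OF _ assms(3)] tensor_relations_diff[OF _ assms(3)]
    unfolding tensor_class_def r_coset_def formal_group_def by (auto; metis)
qed

lemma tensor_class_in: "Poly_Mapping.keys a \<subseteq> pairs \<Longrightarrow> tensor_class M a \<in> cylinder_fields M"
  unfolding cylinder_fields_def cyl_group_def carrier_FactGroup tensor_class_def
  by (rule imageI) (simp add: formal_group_def)

lemma cylinder_fieldsE:
  assumes "V \<in> cylinder_fields M"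
  obtains a where "Poly_Mapping.keys a \<subseteq> pairs" "V = tensor_class M a"
  using assms unfolding cylinder_fields_def cyl_group_def carrier_FactGroup tensor_class_def
  by (auto simp: formal_group_def)

text \<open>A chosen element of a coset is controlled only up to a relation. Hence whatever is
  computed by an additive map that vanishes on the relations may be computed from any
  representative.\<close>

lemma cyl_rep_tensor_class:
  assumes "Poly_Mapping.keys a \<subseteq> pairs"
  shows "cyl_rep (tensor_class M a) - a \<in> tensor_relations M"
proof -
  have "a \<in> tensor_class M a"
    unfolding tensor_class_def r_coset_def using tensor_relations_0
    by (auto simp: formal_group_def intro!: bexI[of _ 0])
  then have "cyl_rep (tensor_class M a) \<in> tensor_class M a"
    unfolding cyl_rep_def by (rule someI)
  then show ?thesis
    by (auto simp: tensor_class_def r_coset_def formal_group_def)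
qed

lemma cyl_rep_keys:
  assumes "V \<in> cylinder_fields M"
  shows "Poly_Mapping.keys (cyl_rep V) \<subseteq> pairs"
proof -
  obtain a where a: "Poly_Mapping.keys a \<subseteq> pairs" "V = tensor_class M a"
    using cylinder_fieldsE[OF assms] .
  have "Poly_Mapping.keys ((cyl_rep V - a) + a) \<subseteq> pairs"
    using tensor_relations_keys[OF cyl_rep_tensor_class[OF a(1)]] a keys_add[of "cyl_rep V - a" a] by blast
  then show ?thesis
    by simp
qed

lemma tensor_class_mult:
  assumes "Poly_Mapping.keys a \<subseteq> pairs" "Poly_Mapping.keys b \<subseteq> pairs"
  shows "tensor_class M a \<otimes>\<^bsub>cyl_group M\<^esub> tensor_class M b = tensor_class M (a + b)"
  using normal.rcos_sum[OF normal_tensor_relations, of a b] assms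
  by (simp add: tensor_class_def cyl_group_def) (simp add: formal_group_def)

lemma tensor_class_inv:
  assumes "Poly_Mapping.keys a \<subseteq> pairs"
  shows "inv\<^bsub>cyl_group M\<^esub> tensor_class M a = tensor_class M (- a)"
proof (rule group.inv_equality)
  show "Group.group (cyl_group M)"
    unfolding cyl_group_def by (rule normal.factorgroup_is_group[OF normal_tensor_relations])
  have "tensor_class M 0 = tensor_relations M"
    using tensor_relations_0 by (auto simp: tensor_class_def r_coset_def formal_group_def)
  then show "tensor_class M (- a) \<otimes>\<^bsub>cyl_group M\<^esub> tensor_class M a = \<one>\<^bsub>cyl_group M\<^esub>"
    using assms by (simp add: tensor_class_mult) (simp add: cyl_group_def)
  show "tensor_class M a \<in> carrier (cyl_group M)" "tensor_class M (- a) \<in> carrier (cyl_group M)"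
    using assms tensor_class_in by (simp_all add: cylinder_fields_def)
qed

lemma frag_eval_tensor_relations:
  assumes "\<And>a. a \<in> tensor_relators M \<Longrightarrow> frag_eval \<phi> a = 0" and "a \<in> tensor_relations M"
  shows "frag_eval \<phi> a = 0"
  using assms(2) unfolding tensor_relations_def
proof (induction a rule: generate.induct)
  case (inv a)
  then have "inv\<^bsub>formal_group M\<^esub> a = - a"
    using tensor_relators_carrier by (auto simp: formal_group_def)
  then show ?case
    using assms(1)[OF inv] by simp
qed (use assms(1) in \<open>auto simp: formal_group_def\<close>)

text \<open>For fixed \<mu>, x and f the map (u, w) to \<open>u \<mu> * w x f\<close> is biadditive
  and lets real scalars pass between the factors, so it vanishes on all three kinds of
  relators.\<close>

lemma cyl_at_tensor_class:
  assumes "Poly_Mapping.keys a \<subseteq> pairs"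
  shows "cyl_at (tensor_class M a) \<mu> x f = frag_eval (\<lambda>p. fst p \<mu> * snd p x f) a"
proof -
  have "frag_eval (\<lambda>p. fst p \<mu> * snd p x f) b = 0" if "b \<in> tensor_relators M" for b
    using that unfolding tensor_relators_def
    by (elim UnE CollectE exE conjE; hypsubst) (simp_all add: vf_add_def vf_mult_def distrib_left distrib_right)
  then have "frag_eval (\<lambda>p. fst p \<mu> * snd p x f) (cyl_rep (tensor_class M a) - a) = 0"
    by (rule frag_eval_tensor_relations[OF _ cyl_rep_tensor_class[OF assms]])
  then show ?thesis
    by (simp add: cyl_at_eq_frag_eval)
qed

lemma cyl_mult_in:
  assumes "V \<in> cylinder_fields M" "Z \<in> cylinder_fields M"
  shows "V \<otimes>\<^bsub>cyl_group M\<^esub> Z \<in> cylinder_fields M"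
    and "cyl_at (V \<otimes>\<^bsub>cyl_group M\<^esub> Z) \<mu> x f = cyl_at V \<mu> x f + cyl_at Z \<mu> x f"
proof -
  obtain a b where a: "Poly_Mapping.keys a \<subseteq> pairs" "V = tensor_class M a"
    and b: "Poly_Mapping.keys b \<subseteq> pairs" "Z = tensor_class M b"
    using assms cylinder_fieldsE by metis
  have "Poly_Mapping.keys (a + b) \<subseteq> pairs"
    using a b keys_add[of a b] by blast
  then show "V \<otimes>\<^bsub>cyl_group M\<^esub> Z \<in> cylinder_fields M"
    and "cyl_at (V \<otimes>\<^bsub>cyl_group M\<^esub> Z) \<mu> x f = cyl_at V \<mu> x f + cyl_at Z \<mu> x f"
    using a b by (simp_all add: tensor_class_mult tensor_class_in cyl_at_tensor_class)
qed

lemma cyl_minus_in: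
  assumes "V \<in> cylinder_fields M" "Z \<in> cylinder_fields M"
  shows "cyl_minus M V Z \<in> cylinder_fields M"
    and "cyl_at (cyl_minus M V Z) \<mu> x f = cyl_at V \<mu> x f - cyl_at Z \<mu> x f"
proof -
  obtain b where b: "Poly_Mapping.keys b \<subseteq> pairs" "Z = tensor_class M b"
    using assms cylinder_fieldsE by metis
  have "inv\<^bsub>cyl_group M\<^esub> Z \<in> cylinder_fields M" "cyl_at (inv\<^bsub>cyl_group M\<^esub> Z) \<mu> x f = - cyl_at Z \<mu> x f"
    using b by (simp_all add: tensor_class_inv tensor_class_in cyl_at_tensor_class)
  then show "cyl_minus M V Z \<in> cylinder_fields M"
    and "cyl_at (cyl_minus M V Z) \<mu> x f = cyl_at V \<mu> x f - cyl_at Z \<mu> x f"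
    using assms by (simp_all add: cyl_minus_def cyl_mult_in)
qed

text \<open>Signs can be absorbed: modulo the relations, minus the generator (u, w) is the generator
  (-u, w). So a difference of two lists is again a list.\<close>

lemma frag_list_representative:
  assumes "Poly_Mapping.keys a \<subseteq> pairs"
  shows "\<exists>ps. set ps \<subseteq> pairs \<and> a - frag_list ps \<in> tensor_relations M"
proof (rule free_Abelian_group_induct[OF assms])
  show "\<exists>ps. set ps \<subseteq> pairs \<and> 0 - frag_list ps \<in> tensor_relations M"
    by (rule exI[of _ "[]"]) (simp add: tensor_relations_0)
next
  fix a b
  assume "\<exists>ps. set ps \<subseteq> pairs \<and> a - frag_list ps \<in> tensor_relations M"
    and "\<exists>ps. set ps \<subseteq> pairs \<and> b - frag_list ps \<in> tensor_relations M"
  then obtain ps qs where ps: "set ps \<subseteq> pairs" "a - frag_list ps \<in> tensor_relations M"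
    and qs: "set qs \<subseteq> pairs" "b - frag_list qs \<in> tensor_relations M"
    by blast
  define neg where "neg = (\<lambda>p :: 'a cylfun \<times> 'a vfield. (\<lambda>\<mu>. (- 1) * fst p \<mu>, snd p))"
  have neg: "neg p \<in> pairs" if "p \<in> pairs" for p
    using that cylinder_funs_cmult[of "fst p" "- 1"] by (auto simp: neg_def)
  have one: "frag_of p + frag_of (neg p) \<in> tensor_relations M" if "p \<in> pairs" for p
  proof -
    \<comment> \<open>The function u + (-1) u is 0, so its additivity relation and the relation for
      the zero function share their leading generator.\<close>
    have "frag_of (\<lambda>\<mu>. 0, snd p) - (frag_of (\<lambda>\<mu>. fst p \<mu> + (- 1) * fst p \<mu>, snd p) -
        frag_of (fst p, snd p) - frag_of (neg p)) \<in> tensor_relations M"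
      unfolding neg_def using that
      by (intro tensor_relations_diff[OF tensor_relation_zero_fun tensor_relation_add_fun]
          cylinder_funs_cmult) auto
    then show ?thesis
      by (simp add: add.commute)
  qed
  have "frag_list qs + frag_list (map neg qs) \<in> tensor_relations M"
    using qs(1)
  proof (induction qs)
    case (Cons q qs)
    then have "(frag_of q + frag_of (neg q)) + (frag_list qs + frag_list (map neg qs)) \<in> tensor_relations M"
      by (intro tensor_relations_add[OF one Cons.IH]) auto
    then show ?case
      by (simp add: algebra_simps)
  qed (simp add: tensor_relations_0)
  then have "(a - frag_list ps) - (b - frag_list qs) - (frag_list qs + frag_list (map neg qs)) \<in> tensor_relations M"
    by (rule tensor_relations_diff[OF tensor_relations_diff[OF ps(2) qs(2)]])
  then have "(a - b) - frag_list (ps @ map neg qs) \<in> tensor_relations M"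
    by (simp add: algebra_simps)
  moreover have "set (ps @ map neg qs) \<subseteq> pairs"
    using ps(1) qs(1) neg unfolding set_append set_map by blast
  ultimately show "\<exists>ps. set ps \<subseteq> pairs \<and> a - b - frag_list ps \<in> tensor_relations M"
    by blast
next
  fix p assume "p \<in> pairs"
  then show "\<exists>ps. set ps \<subseteq> pairs \<and> frag_of p - frag_list ps \<in> tensor_relations M"
    by (intro exI[of _ "[p]"]) (simp add: tensor_relations_0)
qed

lemma vf_sum_list_in:
  "set ps \<subseteq> pairs \<Longrightarrow> (\<lambda>x f. \<Sum>p\<leftarrow>ps. d p * snd p x f) \<in> vector_fields M"
proof (induction ps)
  case (Cons p ps)
  then have "vf_add (vf_mult (\<lambda>x. d p) (snd p)) (\<lambda>x f. \<Sum>p\<leftarrow>ps. d p * snd p x f) \<in> vector_fields M"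
    by (intro vf_add_in vf_cmult_in) auto
  then show ?case
    by (simp add: vf_add_def vf_mult_def)
qed (simp add: vf_zero_in)

text \<open>Expands u \<otimes> w for a linear combination w and moves the scalars to the function
  side. It is used to replace an eliminated field by the remaining ones.\<close>

lemma tensor_relation_lincomb:
  assumes u: "u \<in> cylinder_funs M"
  shows "set ps \<subseteq> pairs \<Longrightarrow> frag_of (u, \<lambda>x f. \<Sum>p\<leftarrow>ps. d p * snd p x f) -
    frag_list (map (\<lambda>p. (\<lambda>\<mu>. d p * u \<mu>, snd p)) ps) \<in> tensor_relations M"
proof (induction ps)
  case (Cons p ps)
  let ?w = "\<lambda>x f. \<Sum>p\<leftarrow>ps. d p * snd p x f"
  have p: "snd p \<in> vector_fields M" and ps: "set ps \<subseteq> pairs"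
    using Cons.prems by auto
  have "(frag_of (u, vf_add (vf_mult (\<lambda>x. d p) (snd p)) ?w) - frag_of (u, vf_mult (\<lambda>x. d p) (snd p)) - frag_of (u, ?w))
     - (frag_of (\<lambda>\<mu>. d p * u \<mu>, snd p) - frag_of (u, vf_mult (\<lambda>x. d p) (snd p)))
     + (frag_of (u, ?w) - frag_list (map (\<lambda>p. (\<lambda>\<mu>. d p * u \<mu>, snd p)) ps)) \<in> tensor_relations M"
    by (rule tensor_relations_add[OF tensor_relations_diff[OF tensor_relation_add_field[OF u]
          tensor_relation_scalar[OF u p]] Cons.IH])
      (intro p vf_cmult_in vf_sum_list_in ps)+
  then show ?case
    by (simp add: vf_add_def vf_mult_def algebra_simps)
qed (simp add: tensor_relation_zero_field u)

lemma tensor_relation_list_add: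
  assumes u: "u \<in> cylinder_funs M"
  shows "set ps \<subseteq> pairs \<Longrightarrow> frag_list (map (\<lambda>p. (\<lambda>\<mu>. fst p \<mu> + d p * u \<mu>, snd p)) ps) - frag_list ps -
    frag_list (map (\<lambda>p. (\<lambda>\<mu>. d p * u \<mu>, snd p)) ps) \<in> tensor_relations M"
proof (induction ps)
  case (Cons p ps)
  then have "(frag_of (\<lambda>\<mu>. fst p \<mu> + d p * u \<mu>, snd p) - frag_of (fst p, snd p) - frag_of (\<lambda>\<mu>. d p * u \<mu>, snd p)) +
    (frag_list (map (\<lambda>p. (\<lambda>\<mu>. fst p \<mu> + d p * u \<mu>, snd p)) ps) - frag_list ps -
    frag_list (map (\<lambda>p. (\<lambda>\<mu>. d p * u \<mu>, snd p)) ps)) \<in> tensor_relations M"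
    by (intro tensor_relations_add[OF tensor_relation_add_fun Cons.IH] cylinder_funs_cmult u) auto
  then show ?case
    by (simp add: algebra_simps)
qed (simp add: tensor_relations_0)

text \<open>
  If some coefficient is nonzero at some measure, the corresponding vector field is a linear
  combination of the others and can be eliminated.
\<close>

lemma frag_list_eval_zero:
  assumes "set ps \<subseteq> pairs" "\<And>\<mu> x f. (\<Sum>p\<leftarrow>ps. fst p \<mu> * snd p x f) = 0"
  shows "frag_list ps \<in> tensor_relations M"
  using assms
proof (induction ps rule: length_induct)
  case (1 ps)
  show ?case
  proof (cases "\<forall>p\<in>set ps. fst p = (\<lambda>\<mu>. 0)")
    case True
    have "frag_of p \<in> tensor_relations M" if p: "p \<in> set ps" for p
    proof -
      have "snd p \<in> vector_fields M" "fst p = (\<lambda>\<mu>. 0)"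
        using True p 1(2) by auto
      then show ?thesis
        using tensor_relation_zero_fun[of "snd p"] by (metis prod.collapse)
    qed
    then show ?thesis
      by (rule tensor_relations_list)
  next
    case False
    then obtain q \<mu>0 where q: "q \<in> set ps" "fst q \<mu>0 \<noteq> 0"
      by (auto simp: fun_eq_iff)
    then obtain as bs where ps: "ps = as @ q # bs"
      by (meson split_list)
    define qs where "qs = as @ bs"
    \<comment> \<open>These are the coefficients obtained by solving the vanishing sum at
      \<open>\<mu>0\<close> for \<open>snd q\<close>. Substituting the solution into the whole list
      produces \<open>zs\<close>, which has one entry fewer and still evaluates to 0
      everywhere.\<close>
    define d where "d p = - (fst p \<mu>0 / fst q \<mu>0)" for p :: "'a cylfun \<times> 'a vfield"
    define zs where "zs = map (\<lambda>p. (\<lambda>\<mu>. fst p \<mu> + d p * fst q \<mu>, snd p)) qs"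
    have qs: "set qs \<subseteq> pairs" and qp: "q \<in> pairs"
      using 1(2) by (auto simp: ps qs_def)
    then have u: "fst q \<in> cylinder_funs M"
      by auto
    have eval: "fst q \<mu> * snd q x f + (\<Sum>p\<leftarrow>qs. fst p \<mu> * snd p x f) = 0" for \<mu> x f
      using 1(3)[of \<mu> x f] by (simp add: ps qs_def)
    have "snd q x f = (\<Sum>p\<leftarrow>qs. d p * snd p x f)" for x f
    proof -
      have "(\<Sum>p\<leftarrow>qs. d p * snd p x f) = - (1 / fst q \<mu>0) * (\<Sum>p\<leftarrow>qs. fst p \<mu>0 * snd p x f)"
        unfolding sum_list_const_mult[symmetric] by (simp add: d_def)
      then have "fst q \<mu>0 * (\<Sum>p\<leftarrow>qs. d p * snd p x f) = fst q \<mu>0 * snd q x f"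
        using eval[of \<mu>0 x f] q(2) by (simp add: field_simps)
      then show ?thesis
        using q(2) by simp
    qed
    then have w: "snd q = (\<lambda>x f. \<Sum>p\<leftarrow>qs. d p * snd p x f)"
      by (intro ext)
    have "frag_list zs \<in> tensor_relations M"
    proof (rule 1(1)[rule_format])
      show "length zs < length ps"
        by (simp add: zs_def qs_def ps)
      show "set zs \<subseteq> pairs"
        using qs u by (auto simp: zs_def intro!: cylinder_funs_add cylinder_funs_cmult)
      fix \<mu> x f
      have "(\<Sum>p\<leftarrow>zs. fst p \<mu> * snd p x f) =
        (\<Sum>p\<leftarrow>qs. fst p \<mu> * snd p x f) + fst q \<mu> * (\<Sum>p\<leftarrow>qs. d p * snd p x f)"
        unfolding sum_list_const_mult[symmetric] sum_list_addf[symmetric]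
        by (simp add: zs_def o_def algebra_simps)
      also have "\<dots> = 0"
        using eval[of \<mu> x f] w by (simp add: fun_eq_iff)
      finally show "(\<Sum>p\<leftarrow>zs. fst p \<mu> * snd p x f) = 0" .
    qed
    moreover have "frag_of (fst q, snd q) - frag_list (map (\<lambda>p. (\<lambda>\<mu>. d p * fst q \<mu>, snd p)) qs)
        \<in> tensor_relations M"
      by (subst w) (rule tensor_relation_lincomb[OF u qs])
    \<comment> \<open>With D for the list of the pairs \<open>(d p u, snd p)\<close>, u =
      \<open>fst q\<close>, this is zs - (zs - qs - D) + (q - D) = q + qs, the given list up to
      order.\<close>
    ultimately have "frag_list zs - (frag_list zs - frag_list qs -
        frag_list (map (\<lambda>p. (\<lambda>\<mu>. d p * fst q \<mu>, snd p)) qs)) +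
      (frag_of (fst q, snd q) - frag_list (map (\<lambda>p. (\<lambda>\<mu>. d p * fst q \<mu>, snd p)) qs)) \<in> tensor_relations M"
      using tensor_relation_list_add[OF u qs, of d, folded zs_def]
      by (blast intro: tensor_relations_add tensor_relations_diff)
    then show ?thesis
      by (simp add: ps qs_def algebra_simps)
  qed
qed

section \<open>Injectivity of evaluation at measures, and cylinder fields as finite sums\<close>

lemma cylinder_fields_list:
  assumes "V \<in> cylinder_fields M"
  obtains ps where "set ps \<subseteq> pairs" "V = tensor_class M (frag_list ps)"
proof -
  obtain a where a: "Poly_Mapping.keys a \<subseteq> pairs" "V = tensor_class M a"
    using cylinder_fieldsE[OF assms] .
  then obtain ps where "set ps \<subseteq> pairs" "a - frag_list ps \<in> tensor_relations M"
    using frag_list_representative by blast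
  then show ?thesis
    using that a tensor_class_eq_iff[OF a(1) keys_frag_list] by blast
qed

lemma cyl_at_inject:
  assumes V: "V \<in> cylinder_fields M" and Z: "Z \<in> cylinder_fields M"
    and eq: "\<And>\<mu>. cyl_at V \<mu> = cyl_at Z \<mu>"
  shows "V = Z"
proof -
  obtain a b where a: "Poly_Mapping.keys a \<subseteq> pairs" "V = tensor_class M a"
    and b: "Poly_Mapping.keys b \<subseteq> pairs" "Z = tensor_class M b"
    using V Z cylinder_fieldsE by metis
  obtain ps where ps: "set ps \<subseteq> pairs" "(a - b) - frag_list ps \<in> tensor_relations M"
    using frag_list_representative[OF keys_diff_subset[OF a(1) b(1)]] by blast
  have "tensor_class M (a - b) = tensor_class M (frag_list ps)"
    by (rule tensor_class_eq_iff[OF keys_diff_subset[OF a(1) b(1)] keys_frag_list[OF ps(1)] ps(2)])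
  then have "frag_eval (\<lambda>p. fst p \<mu> * snd p x f) (a - b) = (\<Sum>p\<leftarrow>ps. fst p \<mu> * snd p x f)" for \<mu> x f
    by (metis cyl_at_tensor_class[OF keys_diff_subset[OF a(1) b(1)]]
        cyl_at_tensor_class[OF keys_frag_list[OF ps(1)]] frag_eval_list)
  moreover have "frag_eval (\<lambda>p. fst p \<mu> * snd p x f) (a - b) = 0" for \<mu> x f
    using eq[of \<mu>] a b by (simp add: cyl_at_tensor_class[symmetric])
  ultimately have "frag_list ps \<in> tensor_relations M"
    by (intro frag_list_eval_zero[OF ps(1)]) simp
  from tensor_relations_add[OF ps(2) this] show ?thesis
    using a b by (simp add: tensor_class_eq_iff)
qed

text \<open>Hides the cosets: later arguments use only such a finite sum, which is not unique, and
  draw conclusions about \<open>cyl_at\<close>.\<close>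

lemma cylinder_fieldE:
  assumes "V \<in> cylinder_fields M"
  obtains n :: nat and u w where "\<And>i. i < n \<Longrightarrow> u i \<in> cylinder_funs M" "\<And>i. i < n \<Longrightarrow> w i \<in> vector_fields M"
    "\<And>\<mu>. cyl_at V \<mu> = (\<lambda>x f. \<Sum>i<n. u i \<mu> * w i x f)"
proof -
  obtain ps where ps: "set ps \<subseteq> pairs" "V = tensor_class M (frag_list ps)"
    using cylinder_fields_list[OF assms] .
  show ?thesis
  proof (rule that[of "length ps" "\<lambda>i. fst (ps ! i)" "\<lambda>i. snd (ps ! i)"])
    fix i assume "i < length ps"
    then have "ps ! i \<in> pairs"
      using ps(1) nth_mem by blast
    then show "fst (ps ! i) \<in> cylinder_funs M" "snd (ps ! i) \<in> vector_fields M"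
      by auto
  next
    show "cyl_at V \<mu> = (\<lambda>x f. \<Sum>i<length ps. fst (ps ! i) \<mu> * snd (ps ! i) x f)" for \<mu>
      using ps keys_frag_list[OF ps(1)]
      by (simp add: fun_eq_iff cyl_at_tensor_class frag_eval_list sum_list_sum_nth atLeast0LessThan)
  qed
qed

lemma cylinder_field_exists:
  assumes I: "finite I" and u: "\<And>i. i \<in> I \<Longrightarrow> u i \<in> cylinder_funs M" and w: "\<And>i. i \<in> I \<Longrightarrow> w i \<in> vector_fields M"
  obtains V where "V \<in> cylinder_fields M" "\<And>\<mu>. cyl_at V \<mu> = (\<lambda>x f. \<Sum>i\<in>I. u i \<mu> * w i x f)"
proof -
  have keys: "Poly_Mapping.keys (\<Sum>i\<in>I. frag_of (u i, w i)) \<subseteq> pairs"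
    using sum_closed_free_Abelian_group[of I "\<lambda>i. frag_of (u i, w i)" pairs] u w by simp
  show ?thesis
    by (rule that[OF tensor_class_in[OF keys]])
      (simp add: fun_eq_iff cyl_at_tensor_class[OF keys] frag_eval_sum)
qed

lemma cyl_at_vector_field:
  assumes "V \<in> cylinder_fields M"
  shows "cyl_at V \<mu> \<in> vector_fields M"
proof -
  obtain n u w where "\<And>i::nat. i < n \<Longrightarrow> u i \<in> cylinder_funs M" "\<And>i. i < n \<Longrightarrow> w i \<in> vector_fields M"
    and V: "\<And>\<mu>. cyl_at V \<mu> = (\<lambda>x f. \<Sum>i<n. u i \<mu> * w i x f)"
    using cylinder_fieldE[OF assms] by blast
  then show ?thesis
    unfolding V by (intro vector_fields_lincomb) auto
qed

lemma cyl_at_cylinder_fun: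
  assumes "V \<in> cylinder_fields M"
  shows "(\<lambda>\<mu>. cyl_at V \<mu> x f) \<in> cylinder_funs M"
proof -
  obtain n u w where u: "\<And>i::nat. i < n \<Longrightarrow> u i \<in> cylinder_funs M" "\<And>i. i < n \<Longrightarrow> w i \<in> vector_fields M"
    and V: "\<And>\<mu>. cyl_at V \<mu> = (\<lambda>x f. \<Sum>i<n. u i \<mu> * w i x f)"
    using cylinder_fieldE[OF assms] by blast
  show ?thesis
    unfolding V by (intro cylinder_funs_sum cylinder_funs_mult cylinder_funs_const u) auto
qed

text \<open>The direction \<open>cyl_at V \<mu>\<close> depends on \<mu>, but linearity in the
  direction pulls the coefficients \<open>v i \<mu>\<close> out and leaves derivatives along fixed
  fields.\<close>

lemma act_in:
  assumes V: "V \<in> cylinder_fields M" and u: "u \<in> cylinder_funs M"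
  shows "act M V u \<in> cylinder_funs M"
proof -
  obtain n v w where v: "\<And>i::nat. i < n \<Longrightarrow> v i \<in> cylinder_funs M" and w: "\<And>i. i < n \<Longrightarrow> w i \<in> vector_fields M"
    and V: "\<And>\<mu>. cyl_at V \<mu> = (\<lambda>x f. \<Sum>i<n. v i \<mu> * w i x f)"
    using cylinder_fieldE[OF V] by blast
  have "act M V u = (\<lambda>\<mu>. \<Sum>i<n. v i \<mu> * dir_deriv M (w i) u \<mu>)"
    by (intro ext, unfold act_eq_dir_deriv V, rule dir_deriv_lincomb[OF u]) (use w in auto)
  then show ?thesis
    using v w u by (auto intro!: cylinder_funs_sum cylinder_funs_mult dir_deriv_in)
qed

text \<open>The definition differentiates the coefficients of one chosen representative. Since the
  values \<open>snd p x f\<close> do not depend on the measure, this equals the derivative of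
  \<open>cyl_at Z\<close> in the measure with x and f held fixed, an expression in which the
  representative no longer occurs.\<close>

lemma nabla_int_in:
  assumes V: "V \<in> cylinder_fields M" and Z: "Z \<in> cylinder_fields M"
  shows "nabla_int M V Z \<in> cylinder_fields M"
    and "cyl_at (nabla_int M V Z) \<mu> x f = act M V (\<lambda>\<nu>. cyl_at Z \<nu> x f) \<mu>"
proof -
  define g where "g p = (act M V (fst p), snd p)" for p :: "'a cylfun \<times> 'a vfield"
  let ?b = "frag_extend (\<lambda>p. frag_of (g p)) (cyl_rep Z)"
  note K = cyl_rep_keys[OF Z]
  have g: "g p \<in> pairs" if "p \<in> pairs" for p
    using that by (auto simp: g_def act_in[OF V])
  have eq: "nabla_int M V Z = tensor_class M ?b"
    by (simp add: nabla_int_def g_def case_prod_unfold)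
  have "Poly_Mapping.keys ?b \<subseteq> (\<Union>p\<in>Poly_Mapping.keys (cyl_rep Z). {g p})"
    using keys_frag_extend[of "\<lambda>p. frag_of (g p)" "cyl_rep Z"] by simp
  then have keys: "Poly_Mapping.keys ?b \<subseteq> pairs"
    using K g by blast
  show "nabla_int M V Z \<in> cylinder_fields M"
    unfolding eq by (rule tensor_class_in[OF keys])
  have "act M V (\<lambda>\<nu>. cyl_at Z \<nu> x f) \<mu> = (\<Sum>p\<in>Poly_Mapping.keys (cyl_rep Z).
      dir_deriv M (cyl_at V \<mu>) (\<lambda>\<nu>. (of_int (Poly_Mapping.lookup (cyl_rep Z) p) * snd p x f) * fst p \<nu>) \<mu>)"
    unfolding act_eq_dir_deriv cyl_at_eq_frag_eval[of Z] frag_eval_def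
    by (subst dir_deriv_sum[OF cyl_at_vector_field[OF V], symmetric])
      (use K in \<open>auto intro!: cylinder_funs_mult cylinder_funs_const simp: mult_ac\<close>)
  also have "\<dots> = (\<Sum>p\<in>Poly_Mapping.keys (cyl_rep Z).
      (of_int (Poly_Mapping.lookup (cyl_rep Z) p) * snd p x f) * dir_deriv M (cyl_at V \<mu>) (fst p) \<mu>)"
    using K by (intro sum.cong refl dir_deriv_cmult cyl_at_vector_field[OF V]) auto
  also have "\<dots> = cyl_at (nabla_int M V Z) \<mu> x f"
    unfolding eq cyl_at_tensor_class[OF keys] frag_eval_extend
    by (simp add: frag_eval_def g_def act_eq_dir_deriv mult_ac)
  finally show "cyl_at (nabla_int M V Z) \<mu> x f = act M V (\<lambda>\<nu>. cyl_at Z \<nu> x f) \<mu>" ..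
qed

end

section \<open>Cylinder vector fields as derivations\<close>

context closed_manifold begin

lemma tangent_vector_inverse:
  assumes v: "v \<in> tangent_space M x" and q: "q \<in> smooth_funs M" and nz: "\<And>y. q y \<noteq> 0"
  shows "v (\<lambda>y. inverse (q y)) = - v q * (inverse (q x) * inverse (q x))"
proof -
  have "v (\<lambda>y. q y * inverse (q y)) = v q * inverse (q x) + q x * v (\<lambda>y. inverse (q y))"
    by (rule tangent_vector_mult[OF v q smooth_funs_inverse[OF q nz]])
  moreover have "v (\<lambda>y. q y * inverse (q y)) = 0"
    using tangent_vector_const[OF v, of 1] nz by simp
  ultimately show ?thesis
    using nz[of x] by (simp add: field_simps)
qed

text \<open>
  The test functions \<open>s / (1 + n (s\<^sup>2 + t\<^sup>2))\<close> have derivatives along w that stay bounded and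
  converge to the derivative of s on the common zero set of s and t, and to 0 elsewhere. With
  \<open>t = w f - (w f)(x)\<close> the function w f is constant on that set, so that no bump functions are
  needed to isolate x.
\<close>

lemma vector_field_zero_at_atom:
  assumes w: "w \<in> vector_fields M" and f: "f \<in> smooth_funs M"
    and zero: "\<And>h. h \<in> smooth_funs M \<Longrightarrow> star (\<lambda>y. w y h) \<nu> = 0"
    and atom: "0 < measure (measure_of_prob \<nu>) {x}"
  shows "w x f = 0"
proof -
  interpret prob_space "measure_of_prob \<nu>" by (rule prob_space_measure_of_prob)
  define s where "s y = f y - f x" for y
  define t where "t y = w y f - w x f" for y
  define q where "q n y = 1 + real n * (s y * s y + t y * t y)" for n y
  define h where "h n y = s y * inverse (q n y)" for n y
  \<comment> \<open>On S the function \<open>\<lambda>y. w y f\<close> has the constant value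
    \<open>w x f\<close>, and x lies in S; so S may replace the single point x.\<close>
  define S where "S = {y. s y = 0 \<and> t y = 0}"
  have s: "s \<in> smooth_funs M" and t: "t \<in> smooth_funs M"
    unfolding s_def[abs_def] t_def[abs_def]
    by (intro smooth_funs_diff f vector_field_smooth[OF w] smooth_funs_const)+
  have q: "q n \<in> smooth_funs M" for n
    unfolding q_def[abs_def] by (intro smooth_funs_add smooth_funs_cmult smooth_funs_mult smooth_funs_const s t)
  have q_ge: "1 \<le> q n y" "real n * (s y * s y + t y * t y) \<le> q n y" for n y
    by (simp_all add: q_def)
  have q_nz: "q n y \<noteq> 0" for n y
    using q_ge[of n y] by linarith
  have h: "h n \<in> smooth_funs M" for n
    unfolding h_def[abs_def] by (intro smooth_funs_mult s smooth_funs_inverse[OF q] q_nz)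
  note wt = vector_field_tangent[OF w]
  have ws: "w y s = w y f" for y
    unfolding s_def[abs_def]
    by (simp add: tangent_vector_diff[OF wt f smooth_funs_const] tangent_vector_const[OF wt])
  have wq: "w y (q n) = real n * (2 * s y * w y f + 2 * t y * w y t)" for n y
    unfolding q_def[abs_def]
    by (simp add: tangent_vector_add[OF wt] tangent_vector_cmult[OF wt] tangent_vector_mult[OF wt]
        tangent_vector_const[OF wt] smooth_funs_add smooth_funs_cmult smooth_funs_mult smooth_funs_const s t ws
        algebra_simps)
  have wh: "w y (h n) = inverse (q n y) * w y f -
      2 * (real n * (s y * s y) * inverse (q n y) * inverse (q n y)) * w y f -
      2 * (real n * (s y * t y) * inverse (q n y) * inverse (q n y)) * w y t" for n y
    unfolding h_def[abs_def]
    by (simp add: tangent_vector_mult[OF wt s smooth_funs_inverse[OF q q_nz]]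
        tangent_vector_inverse[OF wt q q_nz] ws wq algebra_simps)
  obtain a where a: "\<And>y. \<bar>w y f\<bar> \<le> a"
    using smooth_fun_bounded[OF vector_field_smooth[OF w, of f]] by blast
  obtain b where b: "\<And>y. \<bar>w y t\<bar> \<le> b"
    using smooth_fun_bounded[OF vector_field_smooth[OF w, of t]] by blast
  \<comment> \<open>The growing factor n is harmless: q dominates n (s^2 + t^2), hence also n s^2
    and n |s t|. The three terms of \<open>wh\<close> contribute a, 2a and 2b.\<close>
  have bound: "\<bar>w y (h n)\<bar> \<le> 3 * a + 2 * b" for n y
  proof -
    have inv: "0 \<le> inverse (q n y)" "inverse (q n y) \<le> 1"
      using q_ge(1)[of n y] by (simp_all add: inverse_le_1_iff)
    have le1: "\<bar>real n * c * inverse (q n y) * inverse (q n y)\<bar> \<le> 1" if "\<bar>c\<bar> \<le> s y * s y + t y * t y" for c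
    proof -
      have "\<bar>real n * c\<bar> \<le> q n y"
        using mult_left_mono[OF that, of "real n"] q_ge(2)[of n y] by (simp add: abs_mult)
      then have "\<bar>real n * c\<bar> * inverse (q n y) \<le> q n y * inverse (q n y)"
        using inv(1) by (rule mult_right_mono)
      then have "\<bar>real n * c\<bar> * inverse (q n y) \<le> 1"
        using q_nz[of n y] by simp
      then have "\<bar>real n * c\<bar> * inverse (q n y) * inverse (q n y) \<le> 1 * 1"
        using inv by (intro mult_mono) auto
      then show ?thesis
        using inv by (simp add: abs_mult)
    qed
    have "\<bar>s y * t y\<bar> \<le> s y * s y + t y * t y"
    proof -
      have "0 \<le> (\<bar>s y\<bar> - \<bar>t y\<bar>)\<^sup>2" by simp
      then have "\<bar>s y\<bar> * \<bar>t y\<bar> * 2 \<le> s y * s y + t y * t y"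
        by (simp add: power2_eq_square algebra_simps)
      moreover have "0 \<le> \<bar>s y\<bar> * \<bar>t y\<bar>" by simp
      ultimately show ?thesis
        unfolding abs_mult by linarith
    qed
    from le1[OF this]
    have 1: "\<bar>2 * (real n * (s y * t y) * inverse (q n y) * inverse (q n y)) * w y t\<bar> \<le> 2 * (1 * b)"
      using mult_mono[OF _ b[of y], of "\<bar>real n * (s y * t y) * inverse (q n y) * inverse (q n y)\<bar>" 1]
      by (simp add: abs_mult)
    have "\<bar>real n * (s y * s y) * inverse (q n y) * inverse (q n y)\<bar> \<le> 1"
      by (rule le1) simp
    then have 2: "\<bar>2 * (real n * (s y * s y) * inverse (q n y) * inverse (q n y)) * w y f\<bar> \<le> 2 * (1 * a)"
      using mult_mono[OF _ a[of y], of "\<bar>real n * (s y * s y) * inverse (q n y) * inverse (q n y)\<bar>" 1]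
      by (simp add: abs_mult)
    have 3: "\<bar>inverse (q n y) * w y f\<bar> \<le> 1 * a"
      unfolding abs_mult using inv a[of y] by (intro mult_mono) auto
    show ?thesis
      unfolding wh using 1 2 3 by linarith
  qed
  \<comment> \<open>On S one has q = 1 and both correction terms contain the factor s = 0. Off S, q
    grows linearly in n, so every term is of order 1/n.\<close>
  have lim: "(\<lambda>n. w y (h n)) \<longlonglongrightarrow> indicator S y * w x f" for y
  proof (cases "y \<in> S")
    case True
    then have "s y = 0" "t y = 0" by (auto simp: S_def)
    then have "w y (h n) = w x f" for n
      unfolding wh by (simp add: q_def) (simp add: t_def)
    then show ?thesis
      using True by simp
  next
    case False
    define p where "p = s y * s y + t y * t y"
    have p: "0 < p"
      using False unfolding p_def S_def by (metis (mono_tags) mem_Collect_eq sum_squares_gt_zero_iff)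
    have 1: "(\<lambda>n. inverse (1 + real n * p)) \<longlonglongrightarrow> 0"
      using p by real_asymp
    have 2: "(\<lambda>n. real n * c * inverse (1 + real n * p) * inverse (1 + real n * p)) \<longlonglongrightarrow> 0" for c
    proof -
      have "(\<lambda>n. real n * inverse (1 + real n * p) * inverse (1 + real n * p)) \<longlonglongrightarrow> 0"
        using p by real_asymp
      from tendsto_mult_left[OF this, of c] show ?thesis
        by (simp add: mult_ac)
    qed
    have "(\<lambda>n. inverse (1 + real n * p) * w y f -
      2 * (real n * (s y * s y) * inverse (1 + real n * p) * inverse (1 + real n * p)) * w y f -
      2 * (real n * (s y * t y) * inverse (1 + real n * p) * inverse (1 + real n * p)) * w y t)
      \<longlonglongrightarrow> 0 * w y f - 2 * 0 * w y f - 2 * 0 * w y t"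
      by (intro tendsto_intros 1 2)
    then show ?thesis
      using False by (simp add: wh q_def p_def)
  qed
  have [measurable]: "s \<in> borel_measurable borel" "t \<in> borel_measurable borel"
    by (intro smooth_fun_measurable s t)+
  have S [measurable]: "S \<in> sets borel"
    unfolding S_def by measurable
  have "(\<lambda>n. \<integral>y. w y (h n) \<partial>measure_of_prob \<nu>) \<longlonglongrightarrow> (\<integral>y. indicator S y * w x f \<partial>measure_of_prob \<nu>)"
  proof (rule integral_dominated_convergence[where w = "\<lambda>y. 3 * a + 2 * b"])
    show "(\<lambda>y. w y (h n)) \<in> borel_measurable (measure_of_prob \<nu>)" for n
      using smooth_fun_measurable[OF vector_field_smooth[OF w, of "h n"]] by measurable
    show "(\<lambda>y. indicator S y * w x f) \<in> borel_measurable (measure_of_prob \<nu>)"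
      by measurable
  qed (use lim bound in auto)
  moreover have "(\<integral>y. w y (h n) \<partial>measure_of_prob \<nu>) = 0" for n
    using zero[OF h[of n]] by (simp add: star_def)
  ultimately have "(\<integral>y. indicator S y * w x f \<partial>measure_of_prob \<nu>) = 0"
    using LIMSEQ_unique tendsto_const by (metis (no_types, lifting) ext)
  then have "measure (measure_of_prob \<nu>) S * w x f = 0"
    by simp
  \<comment> \<open>The limit of the vanishing integrals is the mass of S times
    \<open>w x f\<close>; the atom at x makes that mass positive.\<close>
  moreover have "measure (measure_of_prob \<nu>) {x} \<le> measure (measure_of_prob \<nu>) S"
    using S by (intro finite_measure_mono) (auto simp: S_def s_def t_def)
  ultimately show ?thesis
    using atom by auto
qed

section \<open>Injectivity of the action on cylinder functions\<close>

lemma act_star: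
  assumes "V \<in> cylinder_fields M" "f \<in> smooth_funs M"
  shows "act M V (star f) \<mu> = star (\<lambda>x. cyl_at V \<mu> x f) \<mu>"
  by (simp add: act_eq_dir_deriv dir_deriv_star[OF assms(2) cyl_at_vector_field[OF assms(1)]])

text \<open>Testing at \<open>\<nu> t\<close> gives information about
  \<open>cyl_at V (\<nu> t)\<close>, a different field from \<open>cyl_at V \<mu>\<close>. The way
  back is that, for fixed x and f, its value is a cylinder function of the measure and hence
  continuous along the mixture.\<close>

lemma cyl_at_eq_0:
  assumes V: "V \<in> cylinder_fields M" and zero: "\<And>f \<mu>. f \<in> smooth_funs M \<Longrightarrow> star (\<lambda>x. cyl_at V \<mu> x f) \<mu> = 0"
  shows "cyl_at V \<mu> x f = 0"
proof (cases "f \<in> smooth_funs M")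
  case True
  obtain \<nu> where \<nu>: "mixes \<mu> x \<nu>"
    using ex_mixes by blast
  have "cyl_at V (\<nu> t) x f = 0" if "0 < t" "t < 1" for t
  proof (rule vector_field_zero_at_atom[OF cyl_at_vector_field[OF V] True zero])
    have "t \<le> measure (measure_of_prob (\<nu> t)) {x}"
      using \<nu> that by (auto simp: mixes_def)
    then show "0 < measure (measure_of_prob (\<nu> t)) {x}"
      using that by linarith
  qed
  then have "\<forall>\<^sub>F t in at_right 0. cyl_at V (\<nu> t) x f = 0"
    by (intro eventually_at_rightI[of 0 1]) auto
  from Lim_transform_eventually[OF mixes_tendsto[OF \<nu> cyl_at_cylinder_fun[OF V]] this]
  show ?thesis
    by (simp add: tendsto_const_iff)
next
  case False
  then show ?thesis
    by (rule tangent_vector_nonsmooth[OF vector_field_tangent[OF cyl_at_vector_field[OF V]]])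
qed

text \<open>The linear functions \<open>star f\<close> are enough as tests, because V acts on them
  by integrating the derivative of f along \<open>cyl_at V \<mu>\<close>.\<close>

lemma act_inject:
  assumes V: "V \<in> cylinder_fields M" and Z: "Z \<in> cylinder_fields M"
    and eq: "\<And>u. u \<in> cylinder_funs M \<Longrightarrow> act M V u = act M Z u"
  shows "V = Z"
proof (rule cyl_at_inject[OF V Z])
  have "star (\<lambda>x. cyl_at (cyl_minus M V Z) \<mu> x f) \<mu> = 0" if f: "f \<in> smooth_funs M" for f \<mu>
    using fun_cong[OF eq[OF cylinder_funs_star[OF f]], of \<mu>]
    by (simp add: cyl_minus_in[OF V Z] act_star[OF V f] act_star[OF Z f]
        star_diff vector_field_smooth cyl_at_vector_field V Z)
  from cyl_at_eq_0[OF cyl_minus_in(1)[OF V Z] this]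
  show "cyl_at V \<mu> = cyl_at Z \<mu>" for \<mu>
    by (simp add: cyl_minus_in(2)[OF V Z] fun_eq_iff)
qed

text \<open>Linearity over real constants only, so that the Lie bracket and a connection are both
  instances although neither is tensorial in all arguments. Finite sums with coefficients are the
  form in which cylinder fields appear.\<close>

definition vf_bilinear :: "('a vfield \<Rightarrow> 'a vfield \<Rightarrow> 'a vfield) \<Rightarrow> bool" where
  "vf_bilinear T \<longleftrightarrow>
     (\<forall>w\<in>vector_fields M. \<forall>z\<in>vector_fields M. T w z \<in> vector_fields M) \<and>
     (\<forall>(n::nat) c w z. (\<forall>i<n. w i \<in> vector_fields M) \<longrightarrow> z \<in> vector_fields M \<longrightarrow>
        T (\<lambda>x f. \<Sum>i<n. c i * w i x f) z = (\<lambda>x f. \<Sum>i<n. c i * T (w i) z x f)) \<and>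
     (\<forall>(n::nat) c w z. w \<in> vector_fields M \<longrightarrow> (\<forall>i<n. z i \<in> vector_fields M) \<longrightarrow>
        T w (\<lambda>x f. \<Sum>i<n. c i * z i x f) = (\<lambda>x f. \<Sum>i<n. c i * T w (z i) x f))"

lemma vf_bilinear_lincomb:
  fixes n m :: nat
  assumes T: "vf_bilinear T"
    and w: "\<And>i. i < n \<Longrightarrow> w i \<in> vector_fields M" and z: "\<And>j. j < m \<Longrightarrow> z j \<in> vector_fields M"
  shows "T (\<lambda>x f. \<Sum>i<n. c i * w i x f) (\<lambda>x f. \<Sum>j<m. d j * z j x f) x f =
    (\<Sum>i<n. \<Sum>j<m. c i * d j * T (w i) (z j) x f)"
proof -
  have "(\<lambda>x f. \<Sum>j<m. d j * z j x f) \<in> vector_fields M"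
    by (rule vector_fields_lincomb) (use z in auto)
  then have "T (\<lambda>x f. \<Sum>i<n. c i * w i x f) (\<lambda>x f. \<Sum>j<m. d j * z j x f) =
    (\<lambda>x f. \<Sum>i<n. c i * T (w i) (\<lambda>x f. \<Sum>j<m. d j * z j x f) x f)"
    using T w unfolding vf_bilinear_def by blast
  moreover have "T (w i) (\<lambda>x f. \<Sum>j<m. d j * z j x f) = (\<lambda>x f. \<Sum>j<m. d j * T (w i) (z j) x f)" if "i < n" for i
    using T w[OF that] z unfolding vf_bilinear_def by blast
  ultimately show ?thesis
    by (simp add: sum_distrib_left mult.assoc)
qed

text \<open>At a fixed measure the coefficients are constants on M, so T expands over pairs of
  indices with coefficients \<open>u i \<mu> * v j \<mu>\<close>, which are again cylinder
  functions.\<close>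

lemma vf_bilinear_field_exists:
  assumes T: "vf_bilinear T" and V: "V \<in> cylinder_fields M" and Z: "Z \<in> cylinder_fields M"
  shows "\<exists>L\<in>cylinder_fields M. \<forall>\<mu>. cyl_at L \<mu> = T (cyl_at V \<mu>) (cyl_at Z \<mu>)"
proof -
  obtain n u w where u: "\<And>i::nat. i < n \<Longrightarrow> u i \<in> cylinder_funs M" "\<And>i. i < n \<Longrightarrow> w i \<in> vector_fields M"
    and V': "\<And>\<mu>. cyl_at V \<mu> = (\<lambda>x f. \<Sum>i<n. u i \<mu> * w i x f)"
    using cylinder_fieldE[OF V] by blast
  obtain m v z where v: "\<And>i::nat. i < m \<Longrightarrow> v i \<in> cylinder_funs M" "\<And>i. i < m \<Longrightarrow> z i \<in> vector_fields M"
    and Z': "\<And>\<mu>. cyl_at Z \<mu> = (\<lambda>x f. \<Sum>i<m. v i \<mu> * z i x f)"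
    using cylinder_fieldE[OF Z] by blast
  let ?I = "{..<n} \<times> {..<m}"
  have "(\<lambda>\<mu>. u (fst p) \<mu> * v (snd p) \<mu>) \<in> cylinder_funs M" "T (w (fst p)) (z (snd p)) \<in> vector_fields M"
    if "p \<in> ?I" for p
    using that u v T by (auto intro: cylinder_funs_mult simp: vf_bilinear_def)
  then obtain L where L: "L \<in> cylinder_fields M"
    "\<And>\<mu>. cyl_at L \<mu> = (\<lambda>x f. \<Sum>p\<in>?I. (u (fst p) \<mu> * v (snd p) \<mu>) * T (w (fst p)) (z (snd p)) x f)"
    by (rule cylinder_field_exists[rotated]) auto
  have lin: "T (\<lambda>x f. \<Sum>i<n. c i * w i x f) (\<lambda>x f. \<Sum>j<m. d j * z j x f) x f =
    (\<Sum>i<n. \<Sum>j<m. c i * d j * T (w i) (z j) x f)" for c d x f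
    by (rule vf_bilinear_lincomb[OF T u(2) v(2)])
  have "cyl_at L \<mu> = T (cyl_at V \<mu>) (cyl_at Z \<mu>)" for \<mu>
    unfolding L(2) V' Z' fun_eq_iff lin
    by (simp add: sum.cartesian_product case_prod_unfold)
  then show ?thesis
    using L(1) by blast
qed

lemma dir_deriv_lincomb_fun:
  assumes W: "W \<in> vector_fields M" and u: "\<And>i. i \<in> I \<Longrightarrow> u i \<in> cylinder_funs M"
  shows "dir_deriv M W (\<lambda>\<nu>. \<Sum>i\<in>I. u i \<nu> * c i) \<mu> = (\<Sum>i\<in>I. dir_deriv M W (u i) \<mu> * c i)"
proof -
  have "dir_deriv M W (\<lambda>\<nu>. \<Sum>i\<in>I. c i * u i \<nu>) \<mu> = (\<Sum>i\<in>I. dir_deriv M W (\<lambda>\<nu>. c i * u i \<nu>) \<mu>)"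
    by (rule dir_deriv_sum[OF W]) (intro cylinder_funs_cmult u)
  also have "\<dots> = (\<Sum>i\<in>I. c i * dir_deriv M W (u i) \<mu>)"
    by (intro sum.cong refl dir_deriv_cmult u W)
  finally show ?thesis
    by (simp add: mult.commute)
qed

lemma dir_deriv_cyl_at:
  assumes W: "W \<in> vector_fields M" and u: "\<And>i::nat. i < n \<Longrightarrow> u i \<in> cylinder_funs M"
    and V: "\<And>\<mu>. cyl_at V \<mu> = (\<lambda>x f. \<Sum>i<n. u i \<mu> * w i x f)"
  shows "dir_deriv M W (\<lambda>\<nu>. cyl_at V \<nu> x f) \<mu> = (\<Sum>i<n. dir_deriv M W (u i) \<mu> * w i x f)"
  unfolding V by (rule dir_deriv_lincomb_fun[OF W]) (use u in auto)

text \<open>T itself does not depend on the measure; only the products of coefficients are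
  differentiated, and each of the two summands of their Leibniz rule is reassembled into a value of
  T.\<close>

lemma dir_deriv_bilinear:
  assumes T: "vf_bilinear T" and V: "V \<in> cylinder_fields M" and Z: "Z \<in> cylinder_fields M"
    and W: "W \<in> vector_fields M"
  shows "dir_deriv M W (\<lambda>\<nu>. T (cyl_at V \<nu>) (cyl_at Z \<nu>) x f) \<mu> =
    T (\<lambda>x f. dir_deriv M W (\<lambda>\<nu>. cyl_at V \<nu> x f) \<mu>) (cyl_at Z \<mu>) x f +
    T (cyl_at V \<mu>) (\<lambda>x f. dir_deriv M W (\<lambda>\<nu>. cyl_at Z \<nu> x f) \<mu>) x f"
proof -
  obtain n u w where u: "\<And>i::nat. i < n \<Longrightarrow> u i \<in> cylinder_funs M" "\<And>i. i < n \<Longrightarrow> w i \<in> vector_fields M"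
    and V': "\<And>\<mu>. cyl_at V \<mu> = (\<lambda>x f. \<Sum>i<n. u i \<mu> * w i x f)"
    using cylinder_fieldE[OF V] by blast
  obtain m v z where v: "\<And>i::nat. i < m \<Longrightarrow> v i \<in> cylinder_funs M" "\<And>i. i < m \<Longrightarrow> z i \<in> vector_fields M"
    and Z': "\<And>\<mu>. cyl_at Z \<mu> = (\<lambda>x f. \<Sum>i<m. v i \<mu> * z i x f)"
    using cylinder_fieldE[OF Z] by blast
  have lin: "T (\<lambda>x f. \<Sum>i<n. c i * w i x f) (\<lambda>x f. \<Sum>j<m. d j * z j x f) x f =
    (\<Sum>i<n. \<Sum>j<m. c i * d j * T (w i) (z j) x f)" for c d x f
    by (rule vf_bilinear_lincomb[OF T u(2) v(2)])
  have dV: "dir_deriv M W (\<lambda>\<nu>. cyl_at V \<nu> x f) \<mu> = (\<Sum>i<n. dir_deriv M W (u i) \<mu> * w i x f)" for x f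
    by (rule dir_deriv_cyl_at[OF W u(1) V'])
  have dZ: "dir_deriv M W (\<lambda>\<nu>. cyl_at Z \<nu> x f) \<mu> = (\<Sum>i<m. dir_deriv M W (v i) \<mu> * z i x f)" for x f
    by (rule dir_deriv_cyl_at[OF W v(1) Z'])
  let ?I = "{..<n} \<times> {..<m}"
  have "T (cyl_at V \<nu>) (cyl_at Z \<nu>) x f =
      (\<Sum>p\<in>?I. (u (fst p) \<nu> * v (snd p) \<nu>) * T (w (fst p)) (z (snd p)) x f)" for \<nu>
    unfolding V' Z' lin by (simp add: sum.cartesian_product case_prod_unfold)
  then have "dir_deriv M W (\<lambda>\<nu>. T (cyl_at V \<nu>) (cyl_at Z \<nu>) x f) \<mu> =
    dir_deriv M W (\<lambda>\<nu>. \<Sum>p\<in>?I. (u (fst p) \<nu> * v (snd p) \<nu>) * T (w (fst p)) (z (snd p)) x f) \<mu>"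
    by (simp only:)
  also have "\<dots> = (\<Sum>p\<in>?I. dir_deriv M W (\<lambda>\<nu>. u (fst p) \<nu> * v (snd p) \<nu>) \<mu> * T (w (fst p)) (z (snd p)) x f)"
    by (rule dir_deriv_lincomb_fun[OF W]) (use u v in \<open>auto intro: cylinder_funs_mult\<close>)
  also have "\<dots> = (\<Sum>p\<in>?I. (dir_deriv M W (u (fst p)) \<mu> * v (snd p) \<mu> +
      u (fst p) \<mu> * dir_deriv M W (v (snd p)) \<mu>) * T (w (fst p)) (z (snd p)) x f)"
    using u v by (intro sum.cong refl arg_cong2[where f = "(*)"] dir_deriv_mult W) auto
  also have "\<dots> = (\<Sum>i<n. \<Sum>j<m. dir_deriv M W (u i) \<mu> * v j \<mu> * T (w i) (z j) x f) +
    (\<Sum>i<n. \<Sum>j<m. u i \<mu> * dir_deriv M W (v j) \<mu> * T (w i) (z j) x f)"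
    by (simp add: sum.cartesian_product case_prod_unfold sum.distrib distrib_right)
  also have "\<dots> = T (\<lambda>x f. dir_deriv M W (\<lambda>\<nu>. cyl_at V \<nu> x f) \<mu>) (cyl_at Z \<mu>) x f +
    T (cyl_at V \<mu>) (\<lambda>x f. dir_deriv M W (\<lambda>\<nu>. cyl_at Z \<nu> x f) \<mu>) x f"
    \<comment> \<open>\<open>dV\<close> and \<open>dZ\<close> have to be applied first, while
      \<open>cyl_at\<close> is still visible under \<open>dir_deriv\<close>.\<close>
    unfolding dV dZ unfolding V' Z' lin ..
  finally show ?thesis .
qed

section \<open>The Lie bracket on M and the bracket of cylinder fields\<close>

lemma tangent_vector_lincomb:
  assumes "v \<in> tangent_space M x" "\<And>i. i \<in> I \<Longrightarrow> f i \<in> smooth_funs M"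
  shows "v (\<lambda>y. \<Sum>i\<in>I. c i * f i y) = (\<Sum>i\<in>I. c i * v (f i))"
proof -
  have "v (\<lambda>y. \<Sum>i\<in>I. c i * f i y) = (\<Sum>i\<in>I. v (\<lambda>y. c i * f i y))"
    by (rule tangent_vector_sum[OF assms(1)]) (intro smooth_funs_cmult assms(2))
  also have "\<dots> = (\<Sum>i\<in>I. c i * v (f i))"
    by (intro sum.cong refl tangent_vector_cmult[OF assms(1)] assms(2))
  finally show ?thesis .
qed

lemma vf_bilinear_lie_bracket: "vf_bilinear lie_bracket"
proof -
  have *: "z x (\<lambda>y. \<Sum>i<n. c i * w i y f) = (\<Sum>i<n. c i * z x (\<lambda>y. w i y f))"
    if "\<forall>i<n. w i \<in> vector_fields M" "z \<in> vector_fields M" for z x w f and n :: nat and c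
    by (rule tangent_vector_lincomb[OF vector_field_tangent[OF that(2)]])
      (use that(1) in \<open>auto intro: vector_field_smooth\<close>)
  show ?thesis
    unfolding vf_bilinear_def
  proof (intro conjI ballI allI impI)
    fix n :: nat and c w z
    assume wz: "\<forall>i<n. w i \<in> vector_fields M" "z \<in> vector_fields M"
    show "lie_bracket (\<lambda>x f. \<Sum>i<n. c i * w i x f) z = (\<lambda>x f. \<Sum>i<n. c i * lie_bracket (w i) z x f)"
      unfolding lie_bracket_def *[OF wz] by (simp add: sum_subtractf right_diff_distrib)
  next
    fix n :: nat and c w z
    assume wz: "w \<in> vector_fields M" "\<forall>i<n. z i \<in> vector_fields M"
    show "lie_bracket w (\<lambda>x f. \<Sum>i<n. c i * z i x f) = (\<lambda>x f. \<Sum>i<n. c i * lie_bracket w (z i) x f)"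
      unfolding lie_bracket_def *[OF wz(2,1)] by (simp add: sum_subtractf right_diff_distrib)
  qed (rule lie_bracket_in)
qed

text \<open>The measure occurs twice, in the field and as the measure of integration. Varying the
  latter differentiates the integrand along W, and this second term is the origin of the Lie bracket
  in the formula for the bracket of cylinder fields.\<close>

lemma dir_deriv_star_cyl_at:
  assumes Z: "Z \<in> cylinder_fields M" and W: "W \<in> vector_fields M" and f: "f \<in> smooth_funs M"
  shows "dir_deriv M W (\<lambda>\<nu>. star (\<lambda>x. cyl_at Z \<nu> x f) \<nu>) \<mu> =
    star (\<lambda>x. dir_deriv M W (\<lambda>\<nu>. cyl_at Z \<nu> x f) \<mu>) \<mu> + star (\<lambda>x. W x (\<lambda>y. cyl_at Z \<mu> y f)) \<mu>"
proof -
  obtain m v z where v: "\<And>i::nat. i < m \<Longrightarrow> v i \<in> cylinder_funs M" and z: "\<And>i. i < m \<Longrightarrow> z i \<in> vector_fields M"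
    and Z': "\<And>\<mu>. cyl_at Z \<mu> = (\<lambda>x f. \<Sum>i<m. v i \<mu> * z i x f)"
    using cylinder_fieldE[OF Z] by blast
  have sm: "(\<lambda>x. z i x f) \<in> smooth_funs M" if "i < m" for i
    using z[OF that] by (rule vector_field_smooth)
  have "star (\<lambda>x. cyl_at Z \<nu> x f) \<nu> = (\<Sum>i<m. v i \<nu> * star (\<lambda>x. z i x f) \<nu>)" for \<nu>
    unfolding Z' by (rule star_sum) (use sm in auto)
  then have "dir_deriv M W (\<lambda>\<nu>. star (\<lambda>x. cyl_at Z \<nu> x f) \<nu>) \<mu> =
    dir_deriv M W (\<lambda>\<nu>. \<Sum>i<m. v i \<nu> * star (\<lambda>x. z i x f) \<nu>) \<mu>"
    by (simp only:)
  also have "\<dots> = (\<Sum>i<m. dir_deriv M W (\<lambda>\<nu>. v i \<nu> * star (\<lambda>x. z i x f) \<nu>) \<mu>)"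
    by (rule dir_deriv_sum[OF W]) (use v sm in \<open>auto intro: cylinder_funs_mult cylinder_funs_star\<close>)
  also have "\<dots> = (\<Sum>i<m. dir_deriv M W (v i) \<mu> * star (\<lambda>x. z i x f) \<mu> +
      v i \<mu> * star (\<lambda>x. W x (\<lambda>y. z i y f)) \<mu>)"
    using v sm by (intro sum.cong refl) (simp add: dir_deriv_mult cylinder_funs_star dir_deriv_star W)
  also have "\<dots> = star (\<lambda>x. \<Sum>i<m. dir_deriv M W (v i) \<mu> * z i x f) \<mu> +
      star (\<lambda>x. \<Sum>i<m. v i \<mu> * W x (\<lambda>y. z i y f)) \<mu>"
    unfolding sum.distrib
    by (intro arg_cong2[where f = "(+)"] star_sum[symmetric] vector_field_smooth[OF W]) (use sm in auto)
  also have "(\<lambda>x. \<Sum>i<m. v i \<mu> * W x (\<lambda>y. z i y f)) = (\<lambda>x. W x (\<lambda>y. cyl_at Z \<mu> y f))"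
    unfolding Z' using sm by (intro ext tangent_vector_lincomb[OF vector_field_tangent[OF W], symmetric]) auto
  also have "(\<lambda>x. \<Sum>i<m. dir_deriv M W (v i) \<mu> * z i x f) = (\<lambda>x. dir_deriv M W (\<lambda>\<nu>. cyl_at Z \<nu> x f) \<mu>)"
    by (intro ext dir_deriv_cyl_at[OF W v Z', symmetric])
  finally show ?thesis .
qed

text \<open>
  The second derivatives of F cancel in the commutator because they are symmetric.
\<close>

lemma act_commutator:
  assumes V: "V \<in> cylinder_fields M" and Z: "Z \<in> cylinder_fields M" and B: "B \<in> cylinder_fields M"
    and eq: "\<And>\<mu> x f. cyl_at B \<mu> x f = cyl_at (nabla_int M V Z) \<mu> x f - cyl_at (nabla_int M Z V) \<mu> x f +
      lie_bracket (cyl_at V \<mu>) (cyl_at Z \<mu>) x f"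
    and u: "u \<in> cylinder_funs M"
  shows "act M B u \<mu> = act M V (act M Z u) \<mu> - act M Z (act M V u) \<mu>"
proof -
  obtain k F f where r: "represents M k F f u"
    using u by (auto simp: cylinder_funs_def)
  define D where "D i \<mu> = partial_deriv i F (star_vec k f \<mu>)" for i \<mu>
  define D2 where "D2 j i = partial_deriv j (partial_deriv i F) (star_vec k f \<mu>)" for j i
  define a where "a X i \<nu> = star (\<lambda>x. cyl_at X \<nu> x (f i)) \<nu>" for X i \<nu>
  note f = represents_smooth[OF r]
  note vf = cyl_at_vector_field
  have D: "D i \<in> cylinder_funs M" if "i < k" for i
    unfolding D_def[abs_def] by (rule represents_in[OF represents_partial[OF r that]])
  have a: "a X i \<in> cylinder_funs M" if "X \<in> cylinder_fields M" "i < k" for X i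
  proof -
    have "a X i = act M X (star (f i))"
      by (simp add: fun_eq_iff a_def act_star[OF that(1) f[OF that(2)]])
    then show ?thesis
      by (simp add: act_in[OF that(1) cylinder_funs_star[OF f[OF that(2)]]])
  qed
  have act: "act M X u \<nu> = (\<Sum>i<k. D i \<nu> * a X i \<nu>)" if "X \<in> cylinder_fields M" for X \<nu>
    unfolding act_eq_dir_deriv D_def a_def by (rule dir_deriv_represents[OF r vf[OF that]])
  \<comment> \<open>Differentiating \<open>D i\<close> gives the terms with second derivatives of F,
    differentiating \<open>a Y i\<close> gives the first-order terms.\<close>
  have act2: "act M X (act M Y u) \<mu> = (\<Sum>i<k. (\<Sum>j<k. D2 j i * a X j \<mu>) * a Y i \<mu>) +
      (\<Sum>i<k. D i \<mu> * (a (nabla_int M X Y) i \<mu> + star (\<lambda>x. cyl_at X \<mu> x (\<lambda>y. cyl_at Y \<mu> y (f i))) \<mu>))"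
    if X: "X \<in> cylinder_fields M" and Y: "Y \<in> cylinder_fields M" for X Y
  proof -
    have "act M Y u = (\<lambda>\<nu>. \<Sum>i<k. D i \<nu> * a Y i \<nu>)"
      by (intro ext act Y)
    then have "act M X (act M Y u) \<mu> = (\<Sum>i<k. dir_deriv M (cyl_at X \<mu>) (\<lambda>\<nu>. D i \<nu> * a Y i \<nu>) \<mu>)"
      unfolding act_eq_dir_deriv[of _ X] using D a[OF Y]
      by (simp only:) (intro dir_deriv_sum vf[OF X] cylinder_funs_mult; simp)
    also have "\<dots> = (\<Sum>i<k. dir_deriv M (cyl_at X \<mu>) (D i) \<mu> * a Y i \<mu> + D i \<mu> * dir_deriv M (cyl_at X \<mu>) (a Y i) \<mu>)"
      by (intro sum.cong refl dir_deriv_mult D a Y vf X) auto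
    also have "\<dots> = (\<Sum>i<k. (\<Sum>j<k. D2 j i * a X j \<mu>) * a Y i \<mu> +
        D i \<mu> * (a (nabla_int M X Y) i \<mu> + star (\<lambda>x. cyl_at X \<mu> x (\<lambda>y. cyl_at Y \<mu> y (f i))) \<mu>))"
    proof (intro sum.cong refl arg_cong2[where f = "(+)"] arg_cong2[where f = "(*)"])
      fix i assume "i \<in> {..<k}"
      then have i: "i < k" by simp
      show "dir_deriv M (cyl_at X \<mu>) (D i) \<mu> = (\<Sum>j<k. D2 j i * a X j \<mu>)"
        unfolding D_def[abs_def] D2_def a_def
        by (rule dir_deriv_represents[OF represents_partial[OF r i] vf[OF X]])
      show "dir_deriv M (cyl_at X \<mu>) (a Y i) \<mu> =
          a (nabla_int M X Y) i \<mu> + star (\<lambda>x. cyl_at X \<mu> x (\<lambda>y. cyl_at Y \<mu> y (f i))) \<mu>"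
        unfolding a_def[abs_def] dir_deriv_star_cyl_at[OF Y vf[OF X] f[OF i]] nabla_int_in(2)[OF X Y]
          act_eq_dir_deriv ..
    qed
    finally show ?thesis
      by (simp add: sum.distrib)
  qed
  have sym: "(\<Sum>i<k. (\<Sum>j<k. D2 j i * a V j \<mu>) * a Z i \<mu>) = (\<Sum>i<k. (\<Sum>j<k. D2 j i * a Z j \<mu>) * a V i \<mu>)"
  proof -
    have "D2 j i = D2 i j" if "i < k" "j < k" for i j
      unfolding D2_def by (rule partial_deriv_commute[OF represents_Ck[OF r] star_vec_in_Espace that(2,1)])
    then have "(\<Sum>i<k. (\<Sum>j<k. D2 j i * a V j \<mu>) * a Z i \<mu>) = (\<Sum>i<k. \<Sum>j<k. D2 i j * a V j \<mu> * a Z i \<mu>)"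
      unfolding sum_distrib_right by (intro sum.cong refl) auto
    also have "\<dots> = (\<Sum>j<k. \<Sum>i<k. D2 i j * a V j \<mu> * a Z i \<mu>)"
      by (rule sum.swap)
    also have "\<dots> = (\<Sum>j<k. (\<Sum>i<k. D2 i j * a Z i \<mu>) * a V j \<mu>)"
      unfolding sum_distrib_right by (intro sum.cong refl) simp
    finally show ?thesis .
  qed
  \<comment> \<open>The first-order parts of the two iterated actions differ exactly by what
    \<open>eq\<close> prescribes for B.\<close>
  have "a B i \<mu> = (a (nabla_int M V Z) i \<mu> + star (\<lambda>x. cyl_at V \<mu> x (\<lambda>y. cyl_at Z \<mu> y (f i))) \<mu>) -
      (a (nabla_int M Z V) i \<mu> + star (\<lambda>x. cyl_at Z \<mu> x (\<lambda>y. cyl_at V \<mu> y (f i))) \<mu>)" if "i < k" for i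
    unfolding a_def eq lie_bracket_def
    by (simp add: star_add star_diff smooth_funs_diff vector_field_smooth vf V Z nabla_int_in(1))
  then show ?thesis
    unfolding act[OF B] act2[OF V Z] act2[OF Z V] sym
    by (simp add: sum_subtractf[symmetric] right_diff_distrib)
qed

text \<open>The description characterises the bracket by its action, so a candidate must be
  produced: the difference of the two intrinsic derivatives plus a cylinder field whose values are
  the Lie brackets on M. \<open>act_commutator\<close> shows that it qualifies and
  \<open>act_inject\<close> that nothing else does.\<close>

lemma cyl_bracket_in:
  assumes V: "V \<in> cylinder_fields M" and Z: "Z \<in> cylinder_fields M"
  shows "cyl_bracket M V Z \<in> cylinder_fields M"
    and "u \<in> cylinder_funs M \<Longrightarrow>
      act M (cyl_bracket M V Z) u = (\<lambda>\<mu>. act M V (act M Z u) \<mu> - act M Z (act M V u) \<mu>)"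
    and "cyl_at (cyl_bracket M V Z) \<mu> x f = cyl_at (nabla_int M V Z) \<mu> x f - cyl_at (nabla_int M Z V) \<mu> x f +
      lie_bracket (cyl_at V \<mu>) (cyl_at Z \<mu>) x f"
proof -
  obtain L where L: "L \<in> cylinder_fields M" "\<And>\<mu>. cyl_at L \<mu> = lie_bracket (cyl_at V \<mu>) (cyl_at Z \<mu>)"
    using vf_bilinear_field_exists[OF vf_bilinear_lie_bracket V Z] by blast
  define B where "B = cyl_minus M (nabla_int M V Z) (nabla_int M Z V) \<otimes>\<^bsub>cyl_group M\<^esub> L"
  have B: "B \<in> cylinder_fields M"
    unfolding B_def by (intro cyl_mult_in cyl_minus_in nabla_int_in V Z L)
  have B_at: "cyl_at B \<mu> x f = cyl_at (nabla_int M V Z) \<mu> x f - cyl_at (nabla_int M Z V) \<mu> x f +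
      lie_bracket (cyl_at V \<mu>) (cyl_at Z \<mu>) x f" for \<mu> x f
    unfolding B_def by (simp add: cyl_mult_in cyl_minus_in nabla_int_in(1) V Z L)
  have B_act: "act M B u = (\<lambda>\<mu>. act M V (act M Z u) \<mu> - act M Z (act M V u) \<mu>)"
    if "u \<in> cylinder_funs M" for u
    by (intro ext act_commutator[OF V Z B B_at that])
  have "cyl_bracket M V Z = B"
    unfolding cyl_bracket_def
    by (rule the_equality) (use B B_act act_inject in \<open>auto simp: B_act\<close>)
  then show "cyl_bracket M V Z \<in> cylinder_fields M"
    and "u \<in> cylinder_funs M \<Longrightarrow>
      act M (cyl_bracket M V Z) u = (\<lambda>\<mu>. act M V (act M Z u) \<mu> - act M Z (act M V u) \<mu>)"
    and "cyl_at (cyl_bracket M V Z) \<mu> x f = cyl_at (nabla_int M V Z) \<mu> x f - cyl_at (nabla_int M Z V) \<mu> x f +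
      lie_bracket (cyl_at V \<mu>) (cyl_at Z \<mu>) x f"
    using B B_at B_act by simp_all
qed

end

section \<open>Curvature\<close>

context closed_manifold begin

text \<open>Constants are smooth functions, and in the second argument the Leibniz term vanishes
  because vector fields annihilate constants.\<close>

lemma connection_bilinear:
  assumes conn: "connection M nabla"
  shows "vf_bilinear nabla"
proof -
  have mem: "nabla w z \<in> vector_fields M" if "w \<in> vector_fields M" "z \<in> vector_fields M" for w z
    using conn that unfolding connection_def by blast
  have add1: "nabla (vf_add w w') z = vf_add (nabla w z) (nabla w' z)"
    if "w \<in> vector_fields M" "w' \<in> vector_fields M" "z \<in> vector_fields M" for w w' z
    using conn that unfolding connection_def by blast
  have add2: "nabla w (vf_add z z') = vf_add (nabla w z) (nabla w z')"
    if "w \<in> vector_fields M" "z \<in> vector_fields M" "z' \<in> vector_fields M" for w z z'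
    using conn that unfolding connection_def by blast
  have cmult1: "nabla (vf_mult (\<lambda>x. c) w) z = vf_mult (\<lambda>x. c) (nabla w z)"
    if "w \<in> vector_fields M" "z \<in> vector_fields M" for c w z
    using conn smooth_funs_const that unfolding connection_def by blast
  have cmult2: "nabla w (vf_mult (\<lambda>x. c) z) = vf_mult (\<lambda>x. c) (nabla w z)"
    if w: "w \<in> vector_fields M" and z: "z \<in> vector_fields M" for c w z
  proof -
    have "nabla w (vf_mult (\<lambda>x. c) z) = vf_add (vf_mult (\<lambda>x. w x (\<lambda>x. c)) z) (vf_mult (\<lambda>x. c) (nabla w z))"
      using conn smooth_funs_const that unfolding connection_def by blast
    then show ?thesis
      by (simp add: vf_add_def vf_mult_def tangent_vector_const[OF vector_field_tangent[OF w]])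
  qed
  \<comment> \<open>Handles the empty sum: homogeneity with the scalar 0 shows that the connection
    vanishes on the zero field.\<close>
  have zero: "(\<lambda>x f. 0) = vf_mult (\<lambda>x. 0) (\<lambda>x f. 0)"
    by (simp add: vf_mult_def)
  have sum_Suc: "(\<lambda>x f. \<Sum>i<Suc n. c i * w i x f) =
      vf_add (\<lambda>x f. \<Sum>i<n. c i * w i x f) (vf_mult (\<lambda>x. c n) (w n))" for n c and w :: "nat \<Rightarrow> 'a vfield"
    by (simp add: vf_add_def vf_mult_def)
  have lin: "(\<lambda>x f. \<Sum>i<n. c i * w i x f) \<in> vector_fields M" if "\<And>i. i < n \<Longrightarrow> w i \<in> vector_fields M" for n :: nat and c w
    by (rule vector_fields_lincomb) (use that in auto)
  have sum1: "nabla (\<lambda>x f. \<Sum>i<n. c i * w i x f) z = (\<lambda>x f. \<Sum>i<n. c i * nabla (w i) z x f)"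
    if "\<And>i. i < n \<Longrightarrow> w i \<in> vector_fields M" and z: "z \<in> vector_fields M" for n :: nat and c w z
    using that(1)
  proof (induction n)
    case 0
    have "nabla (\<lambda>x f. 0) z = vf_mult (\<lambda>x. 0) (nabla (\<lambda>x f. 0) z)"
      using cmult1[OF vf_zero_in z, of 0] by (simp only: zero[symmetric])
    then show ?case
      by (simp add: vf_mult_def)
  next
    case (Suc n)
    then show ?case
      unfolding sum_Suc by (simp add: add1 cmult1 lin vf_cmult_in z)
  qed
  have sum2: "nabla w (\<lambda>x f. \<Sum>i<n. c i * z i x f) = (\<lambda>x f. \<Sum>i<n. c i * nabla w (z i) x f)"
    if w: "w \<in> vector_fields M" and "\<And>i. i < n \<Longrightarrow> z i \<in> vector_fields M" for n :: nat and c w z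
    using that(2)
  proof (induction n)
    case 0
    have "nabla w (\<lambda>x f. 0) = vf_mult (\<lambda>x. 0) (nabla w (\<lambda>x f. 0))"
      using cmult2[OF w vf_zero_in, of 0] by (simp only: zero[symmetric])
    then show ?case
      by (simp add: vf_mult_def)
  next
    case (Suc n)
    then show ?case
      unfolding sum_Suc by (simp add: add2 cmult2 lin vf_cmult_in w)
  qed
  show ?thesis
    unfolding vf_bilinear_def using mem sum1 sum2 by blast
qed

text \<open>\<open>Omega_LC\<close> prescribes values at all measures; such a cylinder field exists
  by bilinearity of the connection and is unique by \<open>cyl_at_inject\<close>.\<close>

lemma nabla_LC_in:
  assumes conn: "connection M nabla" and V: "V \<in> cylinder_fields M" and Z: "Z \<in> cylinder_fields M"
  shows "nabla_LC M nabla V Z \<in> cylinder_fields M"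
    and "cyl_at (nabla_LC M nabla V Z) \<mu> =
      vf_add (cyl_at (nabla_int M V Z) \<mu>) (nabla (cyl_at V \<mu>) (cyl_at Z \<mu>))"
proof -
  obtain T where T: "T \<in> cylinder_fields M" "\<And>\<mu>. cyl_at T \<mu> = nabla (cyl_at V \<mu>) (cyl_at Z \<mu>)"
    using vf_bilinear_field_exists[OF connection_bilinear[OF conn] V Z] by blast
  have "Omega_LC M nabla Z V = T"
    unfolding Omega_LC_def
  proof (rule the_equality)
    fix T'
    assume "T' \<in> cylinder_fields M \<and> (\<forall>\<mu>. cyl_at T' \<mu> = nabla (cyl_at V \<mu>) (cyl_at Z \<mu>))"
    then show "T' = T"
      using T by (intro cyl_at_inject) simp_all
  qed (use T in simp)
  then show "nabla_LC M nabla V Z \<in> cylinder_fields M"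
    and "cyl_at (nabla_LC M nabla V Z) \<mu> =
      vf_add (cyl_at (nabla_int M V Z) \<mu>) (nabla (cyl_at V \<mu>) (cyl_at Z \<mu>))"
    using T by (simp_all add: nabla_LC_def cyl_mult_in nabla_int_in(1) V Z vf_add_def fun_eq_iff)
qed

text \<open>The Leibniz expansion is sorted for antisymmetrisation in X and Y: the third and fourth
  terms are exchanged by swapping X and Y and cancel, the first and last give commutators, and the
  second is compensated by the intrinsic part of the bracket.\<close>

lemma cyl_at_nabla_LC_nabla_LC:
  assumes conn: "connection M nabla"
    and X: "X \<in> cylinder_fields M" and Y: "Y \<in> cylinder_fields M" and Z: "Z \<in> cylinder_fields M"
  shows "cyl_at (nabla_LC M nabla X (nabla_LC M nabla Y Z)) \<mu> x f =
    act M X (act M Y (\<lambda>\<nu>. cyl_at Z \<nu> x f)) \<mu> +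
    nabla (cyl_at (nabla_int M X Y) \<mu>) (cyl_at Z \<mu>) x f +
    nabla (cyl_at Y \<mu>) (cyl_at (nabla_int M X Z) \<mu>) x f +
    nabla (cyl_at X \<mu>) (cyl_at (nabla_int M Y Z) \<mu>) x f +
    nabla (cyl_at X \<mu>) (nabla (cyl_at Y \<mu>) (cyl_at Z \<mu>)) x f"
proof -
  note bil = connection_bilinear[OF conn]
  note vf = cyl_at_vector_field
  \<comment> \<open>The pointwise connection term is itself a cylinder field, so its components are
    cylinder functions and may be differentiated again.\<close>
  obtain T where T: "T \<in> cylinder_fields M" "\<And>\<mu>. cyl_at T \<mu> = nabla (cyl_at Y \<mu>) (cyl_at Z \<mu>)"
    using vf_bilinear_field_exists[OF bil Y Z] by blast
  have nYZ: "nabla_LC M nabla Y Z \<in> cylinder_fields M"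
    by (rule nabla_LC_in(1)[OF conn Y Z])
  have "cyl_at (nabla_int M X (nabla_LC M nabla Y Z)) \<mu> x f =
      dir_deriv M (cyl_at X \<mu>) (\<lambda>\<nu>. cyl_at (nabla_int M Y Z) \<nu> x f + cyl_at T \<nu> x f) \<mu>"
    by (simp add: nabla_int_in(2)[OF X nYZ] act_eq_dir_deriv nabla_LC_in(2)[OF conn Y Z] T(2) vf_add_def)
  also have "\<dots> = dir_deriv M (cyl_at X \<mu>) (\<lambda>\<nu>. cyl_at (nabla_int M Y Z) \<nu> x f) \<mu> +
      dir_deriv M (cyl_at X \<mu>) (\<lambda>\<nu>. cyl_at T \<nu> x f) \<mu>"
    by (intro dir_deriv_add cyl_at_cylinder_fun nabla_int_in T vf X Y Z)
  also have "\<dots> = act M X (act M Y (\<lambda>\<nu>. cyl_at Z \<nu> x f)) \<mu> +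
      (nabla (cyl_at (nabla_int M X Y) \<mu>) (cyl_at Z \<mu>) x f + nabla (cyl_at Y \<mu>) (cyl_at (nabla_int M X Z) \<mu>) x f)"
  proof (rule arg_cong2[where f = "(+)"])
    have "(\<lambda>\<nu>. cyl_at (nabla_int M Y Z) \<nu> x f) = act M Y (\<lambda>\<nu>. cyl_at Z \<nu> x f)"
      by (intro ext nabla_int_in(2) Y Z)
    then show "dir_deriv M (cyl_at X \<mu>) (\<lambda>\<nu>. cyl_at (nabla_int M Y Z) \<nu> x f) \<mu> =
        act M X (act M Y (\<lambda>\<nu>. cyl_at Z \<nu> x f)) \<mu>"
      by (simp add: act_eq_dir_deriv[of M X])
    have "cyl_at (nabla_int M X U) \<mu> = (\<lambda>x f. dir_deriv M (cyl_at X \<mu>) (\<lambda>\<nu>. cyl_at U \<nu> x f) \<mu>)"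
      if "U \<in> cylinder_fields M" for U
      using nabla_int_in(2)[OF X that] by (simp add: fun_eq_iff act_eq_dir_deriv)
    then show "dir_deriv M (cyl_at X \<mu>) (\<lambda>\<nu>. cyl_at T \<nu> x f) \<mu> =
        nabla (cyl_at (nabla_int M X Y) \<mu>) (cyl_at Z \<mu>) x f + nabla (cyl_at Y \<mu>) (cyl_at (nabla_int M X Z) \<mu>) x f"
      using dir_deriv_bilinear[OF bil Y Z vf[OF X], where x = x and f = f and \<mu> = \<mu>] Y Z by (simp add: T(2))
  qed
  finally have 1: "cyl_at (nabla_int M X (nabla_LC M nabla Y Z)) \<mu> x f = \<dots>" .
  have "nabla (cyl_at X \<mu>) (cyl_at (nabla_LC M nabla Y Z) \<mu>) =
      vf_add (nabla (cyl_at X \<mu>) (cyl_at (nabla_int M Y Z) \<mu>)) (nabla (cyl_at X \<mu>) (cyl_at T \<mu>))"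
    using conn vf[OF X] vf[OF nabla_int_in(1)[OF Y Z]] vf[OF T(1)]
    unfolding nabla_LC_in(2)[OF conn Y Z] connection_def T(2) by blast
  then show ?thesis
    unfolding nabla_LC_in(2)[OF conn X nYZ] by (simp add: vf_add_def 1 T(2))
qed

text \<open>For fixed x and f, the map \<nu> to \<open>cyl_at Z \<nu> x f\<close> is a cylinder
  function, on which the bracket acts as a commutator; so all derivatives of Z in the measure
  cancel. What remains of the bracket is its value in the first argument of the connection.\<close>

lemma cyl_at_riemann_der:
  assumes conn: "connection M nabla"
    and X: "X \<in> cylinder_fields M" and Y: "Y \<in> cylinder_fields M" and Z: "Z \<in> cylinder_fields M"
  shows "cyl_at (riemann_der M nabla X Y Z) \<mu> = riemann nabla (cyl_at X \<mu>) (cyl_at Y \<mu>) (cyl_at Z \<mu>)"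
proof (intro ext)
  fix x f
  note vf = cyl_at_vector_field
  let ?B = "cyl_bracket M X Y"
  have B: "?B \<in> cylinder_fields M"
    by (rule cyl_bracket_in(1)[OF X Y])
  have "cyl_at (nabla_int M ?B Z) \<mu> x f =
      act M X (act M Y (\<lambda>\<nu>. cyl_at Z \<nu> x f)) \<mu> - act M Y (act M X (\<lambda>\<nu>. cyl_at Z \<nu> x f)) \<mu>"
    by (simp add: nabla_int_in(2)[OF B Z] cyl_bracket_in(2)[OF X Y cyl_at_cylinder_fun[OF Z]])
  \<comment> \<open>The bracket formula is rearranged so that only sums occur, because additivity of
    a connection is stated for \<open>vf_add\<close>.\<close>
  moreover have "nabla (cyl_at ?B \<mu>) (cyl_at Z \<mu>) x f + nabla (cyl_at (nabla_int M Y X) \<mu>) (cyl_at Z \<mu>) x f =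
      nabla (cyl_at (nabla_int M X Y) \<mu>) (cyl_at Z \<mu>) x f +
      nabla (lie_bracket (cyl_at X \<mu>) (cyl_at Y \<mu>)) (cyl_at Z \<mu>) x f"
  proof -
    have add: "nabla (vf_add w w') (cyl_at Z \<mu>) = vf_add (nabla w (cyl_at Z \<mu>)) (nabla w' (cyl_at Z \<mu>))"
      if "w \<in> vector_fields M" "w' \<in> vector_fields M" for w w'
      using conn that vf[OF Z] unfolding connection_def by blast
    have "vf_add (cyl_at ?B \<mu>) (cyl_at (nabla_int M Y X) \<mu>) =
        vf_add (cyl_at (nabla_int M X Y) \<mu>) (lie_bracket (cyl_at X \<mu>) (cyl_at Y \<mu>))"
      by (simp add: vf_add_def fun_eq_iff cyl_bracket_in(3)[OF X Y])
    from arg_cong[OF this, of "\<lambda>w. nabla w (cyl_at Z \<mu>) x f"] show ?thesis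
      by (simp add: add vf B nabla_int_in(1) X Y lie_bracket_in) (simp add: vf_add_def)
  qed
  ultimately show "cyl_at (riemann_der M nabla X Y Z) \<mu> x f =
      riemann nabla (cyl_at X \<mu>) (cyl_at Y \<mu>) (cyl_at Z \<mu>) x f"
    by (simp add: riemann_der_def riemann_def vf_diff_def cyl_minus_in nabla_LC_in(1)[OF conn] X Y Z B
        cyl_at_nabla_LC_nabla_LC[OF conn] nabla_LC_in(2)[OF conn B Z])
      (simp add: vf_add_def)
qed

end

theorem theorem2p21:
  fixes M :: "('m::{t2_space, second_countable_topology}) manifold"
    and Or :: "'m chart set"
    and g :: "'m \<Rightarrow> 'm tvec \<Rightarrow> 'm tvec \<Rightarrow> real"
    and nabla :: "'m vfield \<Rightarrow> 'm vfield \<Rightarrow> 'm vfield"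
    and V1 V2 V3 :: "'m cylvec"
    and \<mu> :: "'m borel_prob"
  assumes "smooth_manifold M"
    and "compact (UNIV :: 'm set)"
    and "connected (UNIV :: 'm set)"
    and "orientation M Or"
    and "riemannian_metric M g"
    and "levi_civita M g nabla"
    and "V1 \<in> cylinder_fields M" and "V2 \<in> cylinder_fields M" and "V3 \<in> cylinder_fields M"
  shows "cyl_at (riemann_der M nabla V1 V2 V3) \<mu> =
         riemann nabla (cyl_at V1 \<mu>) (cyl_at V2 \<mu>) (cyl_at V3 \<mu>)"
proof -
  interpret closed_manifold M
    by unfold_locales fact+
  have "connection M nabla"
    using assms(6) by (simp add: levi_civita_def)
  then show ?thesis
    by (rule cyl_at_riemann_der) fact+
qed

end
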